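(* Suppose that $\ell\ge r>t\ge1$ are integers, $p>0$ is a real number, and $F$ is a graph with $\chi(F)=\ell+1$. Then $$\pi_{t,p}(H_F^r)=\begin{cases} t!\binom{\ell}{t}\binom{\ell-t}{r-t}^{p}\left(\frac{1}{\ell}\right)^{t+p(r-t)}, & \text{if } p\in(0,1),\\ t!\cdot\lambda_{t,p}(K_\ell^r), & \text{if } p\ge1.\end{cases}$$
   Context: An $r$-graph $\mathcal{H}$ consists of a finite vertex set $V(\mathcal{H})$ and a collection of $r$-subsets of $V(\mathcal{H})$ (its edges). An $r$-graph is $F'$-free if it contains no copy of $F'$ as a (not necessarily induced) subgraph. The ($r$-uniform) expansion $H_F^r$ of a graph $F$ is the $r$-graph obtained from $F$ by adding $r-2$ new vertices into each edge, these $(r-2)$-sets being pairwise disjoint. $\chi(F)$ is the chromatic number. $K_\ell^r$ is the complete $r$-graph on $\ell$ vertices. For $T\subset V(\mathcal{H})$, $d_{\mathcal{H}}(T)$ is the number of edges of $\mathcal{H}$ containing $T$, and $\|\mathcal{H}\|_{t,p} := \sum_{T\in\binom{V(\mathcal{H})}{t}} d_{\mathcal{H}}(T)^p$. $\mathrm{ex}_{t,p}(n,F')$ is the maximum of $\|\mathcal{H}\|_{t,p}$ over all $n$-vertex $F'$-free $r$-graphs, and $\pi_{t,p}(F') := \lim_{n\to\infty}\frac{t!\cdot\mathrm{ex}_{t,p}(n,F')}{n^{t+p(r-t)}}$ (the limit exists). For an $r$-graph $\mathcal{G}$ on $[m]=\{1,\dots,m\}$, let $\partial_{r-t}\mathcal{G}$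 be the set of $t$-subsets of $[m]$ contained in some edge of $\mathcal{G}$, and $L_{\mathcal{G}}(T)=\{I\in\binom{[m]}{r-t}: T\cup I\in\mathcal{G}\}$. With $x_S:=\prod_{i\in S}x_i$, define $L_{\mathcal{G},t,p}(x_1,\dots,x_m):=\sum_{T\in\partial_{r-t}\mathcal{G}}x_T\left(\sum_{I\in L_{\mathcal{G}}(T)}x_I\right)^p$ and $\lambda_{t,p}(\mathcal{G}):=\max\{L_{\mathcal{G},t,p}(x): x\in\Delta^{m-1}\}$, where $\Delta^{m-1}=\{x\in\mathbb{R}^m: x_i\ge0,\ x_1+\dots+x_m=1\}$. *)

theory Defs
  imports "HOL-Analysis.Analysis" "HOL-Library.Ramsey"
begin

datatype 'a hypergraph = Hypergraph (verts: "'a set") (edges: "'a set set")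

definition uniform :: "nat \<Rightarrow> 'a hypergraph \<Rightarrow> bool" where
  "uniform r H \<longleftrightarrow> finite (verts H) \<and> edges H \<subseteq> nsets (verts H) r"

definition complete_hypergraph :: "nat \<Rightarrow> 'a set \<Rightarrow> 'a hypergraph" where
  "complete_hypergraph r V = Hypergraph V (nsets V r)"

definition contains_copy :: "'b hypergraph \<Rightarrow> 'a hypergraph \<Rightarrow> bool" where
  "contains_copy F H \<longleftrightarrow>
     (\<exists>f. inj_on f (verts F) \<and> f ` verts F \<subseteq> verts H \<and> (\<forall>e\<in>edges F. f ` e \<in> edges H))"

definition colourable :: "nat \<Rightarrow> 'a hypergraph \<Rightarrow> bool" where
  "colourable k F \<longleftrightarrow>
     (\<exists>c. c ` verts F \<subseteq> {..<k} \<and> (\<forall>u v. u \<noteq> v \<longrightarrow> {u, v} \<in> edges F \<longrightarrow> c u \<noteq> c v))"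

definition chromatic_number :: "'a hypergraph \<Rightarrow> nat" where
  "chromatic_number F = (LEAST k. colourable k F)"

text \<open>The vertices added into the edge \<open>e\<close> are \<open>Inr (e, i)\<close> with \<open>i < r - 2\<close>; tagging them
  with \<open>e\<close> makes them new and the added sets pairwise disjoint.\<close>

definition expansion :: "nat \<Rightarrow> 'a hypergraph \<Rightarrow> ('a + 'a set \<times> nat) hypergraph" where
  "expansion r F = Hypergraph
     (Inl ` verts F \<union> Inr ` (edges F \<times> {..<r - 2}))
     ((\<lambda>e. Inl ` e \<union> Inr ` ({e} \<times> {..<r - 2})) ` edges F)"

definition deg :: "'a hypergraph \<Rightarrow> 'a set \<Rightarrow> nat" where
  "deg H T = card {e \<in> edges H. T \<subseteq> e}"

definition tp_norm :: "nat \<Rightarrow> real \<Rightarrow> 'a hypergraph \<Rightarrow> real" where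
  "tp_norm t p H = (\<Sum>T\<in>nsets (verts H) t. real (deg H T) powr p)"

text \<open>The maximum is taken over the \<open>F\<close>-free \<open>r\<close>-graphs on the fixed vertex set \<open>{1..n}\<close>.
  The lemmas \<open>ex_tp_upper\<close> and \<open>ex_tp_attained\<close> below show that it is the maximum over all
  \<open>n\<close>-vertex \<open>F\<close>-free \<open>r\<close>-graphs, with vertices of any type.\<close>

definition ex_tp :: "nat \<Rightarrow> nat \<Rightarrow> real \<Rightarrow> nat \<Rightarrow> 'b hypergraph \<Rightarrow> real" where
  "ex_tp r t p n F =
     Max (tp_norm t p ` {H :: nat hypergraph. verts H = {1..n} \<and> uniform r H \<and> \<not> contains_copy F H})"

definition tp_ratio :: "nat \<Rightarrow> nat \<Rightarrow> real \<Rightarrow> 'b hypergraph \<Rightarrow> nat \<Rightarrow> real" where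
  "tp_ratio r t p F n = fact t * ex_tp r t p n F / real n powr (real t + p * real (r - t))"

definition tp_density :: "nat \<Rightarrow> nat \<Rightarrow> real \<Rightarrow> 'b hypergraph \<Rightarrow> real" where
  "tp_density r t p F = lim (tp_ratio r t p F)"

definition shadow :: "nat \<Rightarrow> 'a hypergraph \<Rightarrow> 'a set set" where
  "shadow t G = {T \<in> nsets (verts G) t. \<exists>e\<in>edges G. T \<subseteq> e}"

definition link :: "nat \<Rightarrow> 'a hypergraph \<Rightarrow> 'a set \<Rightarrow> 'a set set" where
  "link k G T = {I \<in> nsets (verts G) k. T \<union> I \<in> edges G}"

definition lagrange_poly :: "nat \<Rightarrow> nat \<Rightarrow> real \<Rightarrow> 'a hypergraph \<Rightarrow> ('a \<Rightarrow> real) \<Rightarrow> real" where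
  "lagrange_poly r t p G x =
     (\<Sum>T\<in>shadow t G. (\<Prod>i\<in>T. x i) * (\<Sum>I\<in>link (r - t) G T. \<Prod>i\<in>I. x i) powr p)"

text \<open>Vectors indexed by \<open>V\<close> are functions that vanish outside \<open>V\<close>.\<close>

definition std_simplex :: "'a set \<Rightarrow> ('a \<Rightarrow> real) set" where
  "std_simplex V = {x. (\<forall>i\<in>V. 0 \<le> x i) \<and> (\<forall>i. i \<notin> V \<longrightarrow> x i = 0) \<and> (\<Sum>i\<in>V. x i) = 1}"

text \<open>The supremum is a maximum, by \<open>lagrangian_max\<close>.\<close>

definition lagrangian :: "nat \<Rightarrow> nat \<Rightarrow> real \<Rightarrow> 'a hypergraph \<Rightarrow> real" where
  "lagrangian r t p G = (SUP x\<in>std_simplex (verts G). lagrange_poly r t p G x)"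

lemma finite_uniform_on: "finite V \<Longrightarrow> finite {H. verts H = V \<and> uniform r H \<and> P H}"
proof -
  assume V: "finite V"
  have "{H. verts H = V \<and> uniform r H \<and> P H} \<subseteq> Hypergraph V ` Pow (Pow V)"
  proof
    fix H assume "H \<in> {H. verts H = V \<and> uniform r H \<and> P H}"
    then show "H \<in> Hypergraph V ` Pow (Pow V)"
      by (cases H) (auto simp: uniform_def nsets_def)
  qed
  then show ?thesis using V by (meson finite_Pow_iff finite_imageI finite_subset)
qed

lemma ex_tp_attained:
  assumes "edges F \<noteq> {}"
  obtains H :: "nat hypergraph" where "verts H = {1..n}" "uniform r H" "\<not> contains_copy F H"
    "tp_norm t p H = ex_tp r t p n F"
proof -
  let ?S = "{H :: nat hypergraph. verts H = {1..n} \<and> uniform r H \<and> \<not> contains_copy F H}"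
  have "Hypergraph {1..n} {} \<in> ?S"
    using assms by (auto simp: uniform_def contains_copy_def)
  then have "tp_norm t p ` ?S \<noteq> {}" by blast
  moreover have "finite (tp_norm t p ` ?S)" by (simp add: finite_uniform_on)
  ultimately have "ex_tp r t p n F \<in> tp_norm t p ` ?S"
    unfolding ex_tp_def by (rule Max_in[rotated])
  then show ?thesis using that by auto
qed

lemma ex_tp_upper:
  fixes H :: "'a hypergraph"
  assumes H: "uniform r H" "card (verts H) = n" "\<not> contains_copy F H" and F: "uniform r F"
  shows "tp_norm t p H \<le> ex_tp r t p n F"
proof -
  have fin: "finite (verts H)" using H by (simp add: uniform_def)
  then obtain g where g: "bij_betw g (verts H) {1..n}"
    using H(2) by (metis card_atLeastAtMost diff_Suc_1 finite_atLeastAtMost finite_same_card_bij)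
  have inj: "inj_on g (verts H)" and im: "g ` verts H = {1..n}"
    using g by (auto simp: bij_betw_def)
  have sub: "e \<subseteq> verts H" if "e \<in> edges H" for e
    using that H(1) by (auto simp: uniform_def nsets_def)
  define H' where "H' = Hypergraph {1..n} ((`) g ` edges H)"
  have uni: "uniform r H'"
    unfolding uniform_def
  proof (intro conjI subsetI)
    show "finite (verts H')" by (simp add: H'_def)
    fix e' assume "e' \<in> edges H'"
    then obtain e where e: "e \<in> edges H" "e' = g ` e" by (auto simp: H'_def)
    have "card e' = r" "finite e'"
      using e H(1) inj_on_subset[OF inj sub[OF e(1)]]
      by (auto simp: uniform_def nsets_def card_image)
    moreover have "e' \<subseteq> {1..n}" using e sub im by (metis image_mono)
    ultimately show "e' \<in> nsets (verts H') r" by (simp add: nsets_def H'_def)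
  qed
  have "\<not> contains_copy F H'"
  proof
    assume "contains_copy F H'"
    then obtain f where f: "inj_on f (verts F)" "f ` verts F \<subseteq> {1..n}"
      "\<And>e. e \<in> edges F \<Longrightarrow> f ` e \<in> (`) g ` edges H"
      by (auto simp: contains_copy_def H'_def)
    let ?k = "inv_into (verts H) g"
    have k: "inj_on ?k {1..n}" "?k ` {1..n} = verts H"
      using bij_betw_inv_into[OF g] by (auto simp: bij_betw_def)
    have "inj_on (?k \<circ> f) (verts F)"
      using f k by (meson comp_inj_on inj_on_subset)
    moreover have "(?k \<circ> f) ` verts F \<subseteq> verts H" using f(2) k(2) by (metis image_comp image_mono)
    moreover have "(?k \<circ> f) ` e \<in> edges H" if eF: "e \<in> edges F" for e
    proof -
      obtain d where d: "d \<in> edges H" "f ` e = g ` d" using f(3)[OF eF] by auto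
      then have "(?k \<circ> f) ` e = d"
        using sub[OF d(1)] inj by (metis image_comp inv_into_image_cancel)
      with d show ?thesis by simp
    qed
    ultimately show False using H(3) unfolding contains_copy_def by blast
  qed
  moreover have "tp_norm t p H' = tp_norm t p H"
  proof -
    have deg: "deg H' (g ` T) = deg H T" if T: "T \<subseteq> verts H" for T
    proof -
      have "{e \<in> edges H'. g ` T \<subseteq> e} = (`) g ` {e \<in> edges H. T \<subseteq> e}"
        using sub inj_on_image_subset_iff[OF inj T] by (auto simp: H'_def)
      moreover have "inj_on ((`) g) {e \<in> edges H. T \<subseteq> e}"
        using sub inj by (intro inj_onI) (metis (no_types, lifting) inj_on_image_eq_iff mem_Collect_eq)
      ultimately show ?thesis by (simp add: deg_def card_image)
    qed
    have "bij_betw ((`) g) (nsets (verts H) t) (nsets {1..n} t)"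
      using g by (rule bij_betw_nsets)
    then show ?thesis
      unfolding tp_norm_def
      by (subst sum.reindex_bij_betw[symmetric])
        (auto simp: H'_def[THEN arg_cong, of verts] nsets_def deg intro!: sum.cong)
  qed
  ultimately show ?thesis
    using uni unfolding ex_tp_def
    by (intro Max_ge) (auto simp: finite_uniform_on H'_def intro!: image_eqI[of _ _ H'])
qed

lemma lagrangian_max:
  fixes G :: "'a hypergraph"
  assumes V: "finite (verts G)" "verts G \<noteq> {}" and p: "p > 0"
  obtains x where "x \<in> std_simplex (verts G)" "lagrange_poly r t p G x = lagrangian r t p G"
    "\<And>y. y \<in> std_simplex (verts G) \<Longrightarrow> lagrange_poly r t p G y \<le> lagrangian r t p G"
proof -
  let ?V = "verts G"
  let ?S = "std_simplex ?V"
  have "compact (Pi\<^sub>E UNIV (\<lambda>i::'a. {0..1::real}))"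
    using compactin_PiE[of "\<lambda>_. euclidean" UNIV "\<lambda>i::'a. {0..1::real}"]
    by (simp add: euclidean_product_topology)
  moreover have "closed ?S"
  proof -
    have "?S = (\<Inter>i\<in>?V. {x. 0 \<le> x i}) \<inter> (\<Inter>i\<in>-?V. {x. x i = 0}) \<inter> {x. (\<Sum>i\<in>?V. x i) = 1}"
      by (auto simp: std_simplex_def)
    also have "closed \<dots>"
      by (intro closed_Int closed_INT ballI closed_Collect_le closed_Collect_eq continuous_intros
          continuous_on_product_coordinates)
    finally show ?thesis .
  qed
  moreover have "?S \<subseteq> Pi\<^sub>E UNIV (\<lambda>i. {0..1})"
  proof
    fix x assume x: "x \<in> ?S"
    have "x i \<le> 1" if "i \<in> ?V" for i
      using member_le_sum[of i ?V x] that x V by (auto simp: std_simplex_def)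
    then show "x \<in> Pi\<^sub>E UNIV (\<lambda>i. {0..1})"
      using x by (auto simp: std_simplex_def PiE_def)
        (metis order_refl, metis zero_le_one)
  qed
  ultimately have "compact ?S" by (metis compact_Int_closed inf.absorb2)
  moreover have "?S \<noteq> {}"
  proof -
    obtain v where "v \<in> ?V" using V by auto
    then have "(\<lambda>i. if i = v then 1 else 0) \<in> ?S" using V by (auto simp: std_simplex_def)
    then show ?thesis by blast
  qed
  moreover have "continuous_on ?S (lagrange_poly r t p G)"
  proof -
    have "0 \<le> (\<Sum>I\<in>link (r - t) G T. \<Prod>i\<in>I. x i)" if "x \<in> ?S" for x T
      using that by (intro sum_nonneg prod_nonneg) (auto simp: std_simplex_def link_def nsets_def)
    then show ?thesis
      unfolding lagrange_poly_def using p
      by (intro continuous_on_sum continuous_on_mult continuous_on_powr' continuous_on_prod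
          continuous_intros continuous_on_subset[OF continuous_on_product_coordinates subset_UNIV]) auto
  qed
  ultimately obtain x where x: "x \<in> ?S" "\<forall>y\<in>?S. lagrange_poly r t p G y \<le> lagrange_poly r t p G x"
    using continuous_attains_sup by blast
  then have "lagrangian r t p G = lagrange_poly r t p G x"
    unfolding lagrangian_def by (intro cSup_eq_maximum) auto
  with x that show ?thesis by metis
qed

end

(*
  The norm of a hypergraph is the value at the all-ones vector of a homogeneous function "wnorm",
  whose maximum over the simplex for the complete hypergraph is the Lagrangian.

  Lower bound: blow up the complete r-graph on l vertices with part sizes proportional to a point x
  of the simplex; a copy of the expansion of F in it would l-colour F.

  Upper bound: let H contain no copy of the expansion. Call a pair of vertices rich if it lies in at
  least delta * n^(r-2) edges. If the graph E of rich pairs contained a complete (l+1)-partite graph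
  with large parts, then F would embed into it, and the added vertices could be chosen greedily. By
  the theorem of Erdos on dense partite hypergraphs, E therefore has only o(n^(l+1)) cliques of size
  l + 1. Edges of H with a poor pair contribute little to the norm, so it suffices to bound the norm
  of the hypergraph of r-cliques of E. For p >= 1, Jensen's inequality shows that the normalised norm
  is at most its average over the induced subgraphs on m vertices (m fixed), nearly all of which have
  no clique of size l + 1; this replaces the removal lemma. For these, Zykov symmetrisation of the
  weights (wnorm is convex along the exchange of weight between two nonadjacent vertices)
  concentrates the weight on a clique, which gives the Lagrangian of the complete r-graph. For p < 1,
  the power mean inequality reduces the bound to the numbers of t- and r-cliques, that is to the case
  p = 1 and t = 0, where Maclaurin's inequality computes the Lagrangian.
*)
theory Submission
  imports Defs
begin

section \<open>Power means and powers of sums\<close>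

text \<open>Every summand of the norm is the weight of T times the p-th power of a link sum. Two
  nonadjacent vertices never lie in a common clique, so moving weight between them changes at most
  one of the two factors, and affinely (before taking the power). For p < 1 the power is concave and
  symmetrisation fails. There the power mean inequality over the t-cliques separates the norm into
  two clique counts, both maximal at the same uniform weights; at these weights all link sums agree,
  so nothing is lost and the answer is explicit. For p >= 1 the best weights need not be uniform,
  hence the Lagrangian. Sampling can replace removal because an m-set with an (l + 1)-clique may be
  charged the trivial bound for each such clique: m is fixed before the permitted clique density, so
  the average charge is as small as desired. Order of constants: \<epsilon> gives m and a clique
  density \<delta>' and, separately, the threshold \<delta> of rich pairs; only then is n taken
  large in terms of all of them. Exponents such as r - 3 are written as real quotients n ^ r / n ^
  3, so that r = 2 is no special case.\<close>

lemma powr_convex_nonneg: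
  fixes p :: real
  assumes p: "p \<ge> 1"
  shows "convex_on {0..} (\<lambda>x. x powr p)"
proof (rule convex_onI)
  fix u x y :: real
  assume u: "0 < u" "u < 1" and xy: "x \<in> {0..}" "y \<in> {0..}"
  have le: "v powr p \<le> v" if "0 < v" "v < 1" for v :: real
    using powr_mono'[of 1 p v] p that by simp
  \<comment> \<open>At a zero endpoint convexity reduces to \<open>le\<close>, that is v powr p <= v
    on the unit interval; otherwise it is convexity on the positive reals.\<close>
  consider "x = 0" | "y = 0" | "x > 0" "y > 0" using xy by force
  then show "((1 - u) *\<^sub>R x + u *\<^sub>R y) powr p \<le> (1 - u) * x powr p + u * y powr p"
  proof cases
    case 1
    then show ?thesis using le[of u] u xy by (simp add: powr_mult mult_right_mono)
  next
    case 2
    then show ?thesis using le[of "1 - u"] u xy by (simp add: powr_mult mult_right_mono)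
  next
    case 3
    then show ?thesis using powr_convex[OF p] u by (simp add: convex_on_def)
  qed
qed simp

text \<open>Jensen's inequality with the weights 1 / card X, multiplied by the p-th power of card
  X.\<close>

lemma sum_powr_power_mean:
  fixes p :: real and y :: "'a \<Rightarrow> real"
  assumes p: "p \<ge> 1" and X: "finite X" and y: "\<And>i. i \<in> X \<Longrightarrow> 0 \<le> y i"
  shows "(\<Sum>i\<in>X. y i) powr p \<le> real (card X) powr (p - 1) * (\<Sum>i\<in>X. y i powr p)"
proof (cases "X = {}")
  case False
  define N where "N = real (card X)"
  have N: "N > 0" using False X by (simp add: N_def card_gt_0_iff)
  have "(\<Sum>i\<in>X. (1 / N) *\<^sub>R y i) powr p \<le> (\<Sum>i\<in>X. (1 / N) * y i powr p)"
    using N y X False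
    by (intro convex_on_sum[OF _ _ powr_convex_nonneg[OF p]]) (auto simp: N_def)
  then have "(1 / N) powr p * (\<Sum>i\<in>X. y i) powr p \<le> (1 / N) * (\<Sum>i\<in>X. y i powr p)"
    using N by (simp flip: sum_distrib_left sum_divide_distrib add: powr_mult powr_divide sum_nonneg y)
  then have "N powr p * ((1 / N) powr p * (\<Sum>i\<in>X. y i) powr p)
      \<le> N powr p * ((1 / N) * (\<Sum>i\<in>X. y i powr p))"
    by (rule mult_left_mono) simp
  then show ?thesis
    using N by (simp add: powr_divide powr_diff N_def)
qed simp

text \<open>The convex case for the exponent 1 / p, applied to the numbers \<open>y i powr p\<close>
  and then raised to the power p.\<close>

lemma sum_powr_power_mean_concave:
  fixes p :: real and y :: "'a \<Rightarrow> real"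
  assumes p: "0 < p" "p < 1" and X: "finite X" and y: "\<And>i. i \<in> X \<Longrightarrow> 0 \<le> y i"
  shows "(\<Sum>i\<in>X. y i powr p) \<le> real (card X) powr (1 - p) * (\<Sum>i\<in>X. y i) powr p"
proof -
  have s: "0 \<le> (\<Sum>i\<in>X. y i powr p)" by (simp add: sum_nonneg)
  have "(\<Sum>i\<in>X. y i powr p) powr (1 / p)
      \<le> real (card X) powr (1 / p - 1) * (\<Sum>i\<in>X. (y i powr p) powr (1 / p))"
    using p X by (intro sum_powr_power_mean) auto
  also have "(\<Sum>i\<in>X. (y i powr p) powr (1 / p)) = (\<Sum>i\<in>X. y i)"
    using p y by (intro sum.cong) (auto simp: powr_powr)
  finally have "((\<Sum>i\<in>X. y i powr p) powr (1 / p)) powr p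
      \<le> (real (card X) powr (1 / p - 1) * (\<Sum>i\<in>X. y i)) powr p"
    using p by (intro powr_mono2) auto
  then show ?thesis
    using p s y by (simp add: powr_powr powr_mult sum_nonneg left_diff_distrib)
qed

text \<open>A substitute for a Lipschitz bound, which fails near 0 for p < 1. Uniform continuity on
  the unit interval handles small b; once b reaches the modulus d, the term C * b with C = 1 / d is
  at least 1 and dominates the left side.\<close>

lemma powr_add_le_uniform:
  fixes p \<eta> :: real
  assumes p: "p > 0" and \<eta>: "\<eta> > 0"
  obtains C where "C \<ge> 0" 
    "\<And>a b. 0 \<le> a \<Longrightarrow> 0 \<le> b \<Longrightarrow> a + b \<le> 1 \<Longrightarrow> (a + b) powr p \<le> a powr p + \<eta> + C * b"
proof -
  have "uniformly_continuous_on {0..1} (\<lambda>x::real. x powr p)"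
    using p by (intro compact_uniformly_continuous continuous_on_powr' continuous_intros) auto
  then obtain d where d: "d > 0"
    "\<And>x y. x \<in> {0..1} \<Longrightarrow> y \<in> {0..1} \<Longrightarrow> dist y x < d \<Longrightarrow> dist (y powr p) (x powr p) < \<eta>"
    using \<eta> unfolding uniformly_continuous_on_def by metis
  show thesis
  proof (rule that)
    show "1 / d \<ge> 0" using d by simp
    fix a b :: real assume ab: "0 \<le> a" "0 \<le> b" "a + b \<le> 1"
    show "(a + b) powr p \<le> a powr p + \<eta> + 1 / d * b"
    proof (cases "b < d")
      case True
      then have "dist ((a + b) powr p) (a powr p) < \<eta>" using d(2)[of a "a + b"] ab by (simp add: dist_real_def)
      moreover have "0 \<le> 1 / d * b" using ab d by simp
      ultimately show ?thesis unfolding dist_real_def by linarith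
    next
      case False
      then have "1 \<le> 1 / d * b" using d by simp
      moreover have "(a + b) powr p \<le> 1" using ab p powr_mono2[of p "a + b" 1] by simp
      moreover have "0 \<le> a powr p" by simp
      ultimately show ?thesis using \<eta> by linarith
    qed
  qed
qed

section \<open>Weighted norms\<close>

text \<open>\<open>C\<close> selects the (t + k)-sets that count: edges, cliques, or all sets. T
  ranges over all t-sets instead of the shadow, because a T in no selected set has an empty inner
  sum, and \<open>0 powr p\<close> is 0.\<close>

definition wnorm :: "('a set \<Rightarrow> bool) \<Rightarrow> nat \<Rightarrow> nat \<Rightarrow> real \<Rightarrow> 'a set \<Rightarrow> ('a \<Rightarrow> real) \<Rightarrow> real" where
  "wnorm C t k p V x =
     (\<Sum>T\<in>nsets V t. (\<Prod>i\<in>T. x i) * (\<Sum>I\<in>{I \<in> nsets (V - T) k. C (T \<union> I)}. \<Prod>i\<in>I. x i) powr p)"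

definition codeg :: "('a set \<Rightarrow> bool) \<Rightarrow> nat \<Rightarrow> 'a set \<Rightarrow> 'a set \<Rightarrow> nat" where
  "codeg C k V T = card {I \<in> nsets (V - T) k. C (T \<union> I)}"

lemma wnorm_one: "wnorm C t k p V (\<lambda>_. 1) = (\<Sum>T\<in>nsets V t. real (codeg C k V T) powr p)"
  by (simp add: wnorm_def codeg_def)

lemma nsets_choose: "finite V \<Longrightarrow> card (nsets V k) = card V choose k"
  using n_subsets[of V k] by (simp add: nsets_def) (metis (no_types, lifting) Collect_cong finite_subset)

lemma deg_eq_codeg:
  assumes H: "uniform r H" and T: "T \<in> nsets (verts H) t" and r: "t \<le> r"
  shows "deg H T = codeg (\<lambda>e. e \<in> edges H) (r - t) (verts H) T"
proof -
  have "bij_betw (\<lambda>I. T \<union> I) {I \<in> nsets (verts H - T) (r - t). T \<union> I \<in> edges H} {e \<in> edges H. T \<subseteq> e}"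
  proof (rule bij_betw_byWitness[where f' = "\<lambda>e. e - T"])
    show "(\<lambda>e. e - T) ` {e \<in> edges H. T \<subseteq> e} \<subseteq> {I \<in> nsets (verts H - T) (r - t). T \<union> I \<in> edges H}"
      using H T by (auto simp: uniform_def nsets_def card_Diff_subset Un_absorb1)
  qed (auto simp: nsets_def)
  then show ?thesis by (simp add: deg_def codeg_def bij_betw_same_card)
qed

lemma tp_norm_eq_wnorm:
  assumes "uniform r H" "t \<le> r"
  shows "tp_norm t p H = wnorm (\<lambda>e. e \<in> edges H) t (r - t) p (verts H) (\<lambda>_. 1)"
  using assms by (simp add: tp_norm_def wnorm_one deg_eq_codeg cong: sum.cong)

text \<open>\<open>link\<close> does not ask I to avoid T, but an edge T \<union> I with r elements
  forces it. The t-sets outside the shadow, which occur if V has fewer than r elements, contribute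
  \<open>0 powr p\<close>, which is 0.\<close>

lemma lagrange_poly_complete:
  assumes V: "finite V" and r: "t \<le> r"
  shows "lagrange_poly r t p (complete_hypergraph r V) x = wnorm (\<lambda>_. True) t (r - t) p V x"
proof -
  let ?G = "complete_hypergraph r V"
  have link: "link (r - t) ?G T = {I \<in> nsets (V - T) (r - t). True}" if T: "T \<in> nsets V t" for T
  proof -
    have "card (T \<union> I) = r \<longleftrightarrow> I \<inter> T = {}" if "I \<in> nsets V (r - t)" for I
      using that T r card_Un_Int[of T I]
      by (auto simp: nsets_def Int_commute)
    then show ?thesis
      using T by (auto simp: link_def complete_hypergraph_def nsets_def)
  qed
  have shadow: "{I \<in> nsets (V - T) (r - t). True} = {}" if T: "T \<in> nsets V t - shadow t ?G" for T
  proof -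
    have "T \<union> I \<in> nsets V r" if "I \<in> nsets (V - T) (r - t)" for I
    proof -
      have "T \<inter> I = {}" using that by (auto simp: nsets_def)
      then show ?thesis using that T r by (auto simp: nsets_def card_Un_disjoint)
    qed
    then show ?thesis
      using T by (fastforce simp: shadow_def complete_hypergraph_def)
  qed
  have "lagrange_poly r t p ?G x =
      (\<Sum>T\<in>shadow t ?G. (\<Prod>i\<in>T. x i) * (\<Sum>I\<in>{I \<in> nsets (V - T) (r - t). True}. \<Prod>i\<in>I. x i) powr p)"
    unfolding lagrange_poly_def
    by (intro sum.cong refl, subst link) (auto simp: shadow_def complete_hypergraph_def)
  also have "\<dots> = wnorm (\<lambda>_. True) t (r - t) p V x"
    unfolding wnorm_def
  proof (intro sum.mono_neutral_left ballI)
    fix T assume "T \<in> nsets V t - shadow t ?G"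
    from shadow[OF this] show "(\<Prod>i\<in>T. x i) * (\<Sum>I\<in>{I \<in> nsets (V - T) (r - t). True}. \<Prod>i\<in>I. x i) powr p = 0"
      by simp
  qed (use V in \<open>auto simp: shadow_def complete_hypergraph_def finite_imp_finite_nsets\<close>)
  finally show ?thesis .
qed

section \<open>Symmetrisation\<close>

definition clique :: "('a \<Rightarrow> 'a \<Rightarrow> bool) \<Rightarrow> 'a set \<Rightarrow> bool" where
  "clique E S \<longleftrightarrow> (\<forall>a\<in>S. \<forall>b\<in>S. a \<noteq> b \<longrightarrow> E a b)"

lemma clique_mono: "clique E S \<Longrightarrow> S' \<subseteq> S \<Longrightarrow> clique E S'"
  by (auto simp: clique_def)

text \<open>A set that leaves U contains a vertex of weight 0, so its product vanishes; inside U the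
  predicate \<open>C\<close> always holds.\<close>

lemma wnorm_restrict_support:
  assumes V: "finite V" and U: "U \<subseteq> V" and x: "\<And>i. i \<in> V - U \<Longrightarrow> x i = 0"
    and C: "\<And>S. S \<subseteq> U \<Longrightarrow> C S"
  shows "wnorm C t k p V x = wnorm (\<lambda>_. True) t k p U x"
proof -
  have zero: "(\<Prod>i\<in>S. x i) = 0" if "S \<subseteq> V" "\<not> S \<subseteq> U" for S
    using that x V by (intro prod_zero) (auto intro: finite_subset)
  have inner: "(\<Sum>I\<in>{I \<in> nsets (V - T) k. C (T \<union> I)}. \<Prod>i\<in>I. x i)
      = (\<Sum>I\<in>{I \<in> nsets (U - T) k. True}. \<Prod>i\<in>I. x i)" if "T \<subseteq> U" for T
  proof (rule sum.mono_neutral_right)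
    show "{I \<in> nsets (U - T) k. True} \<subseteq> {I \<in> nsets (V - T) k. C (T \<union> I)}"
      using U that by (fastforce simp: nsets_def intro!: C)
    show "\<forall>I\<in>{I \<in> nsets (V - T) k. C (T \<union> I)} - {I \<in> nsets (U - T) k. True}. (\<Prod>i\<in>I. x i) = 0"
      by (intro ballI zero) (auto simp: nsets_def)
  qed (use V in \<open>simp add: finite_imp_finite_nsets\<close>)
  have "wnorm C t k p V x =
     (\<Sum>T\<in>nsets U t. (\<Prod>i\<in>T. x i) * (\<Sum>I\<in>{I \<in> nsets (V - T) k. C (T \<union> I)}. \<Prod>i\<in>I. x i) powr p)"
    unfolding wnorm_def
  proof (rule sum.mono_neutral_right)
    show "\<forall>T\<in>nsets V t - nsets U t.
      (\<Prod>i\<in>T. x i) * (\<Sum>I\<in>{I \<in> nsets (V - T) k. C (T \<union> I)}. \<Prod>i\<in>I. x i) powr p = 0"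
    proof
      fix T assume "T \<in> nsets V t - nsets U t"
      then have "(\<Prod>i\<in>T. x i) = 0" by (intro zero) (auto simp: nsets_def)
      then show "(\<Prod>i\<in>T. x i) * (\<Sum>I\<in>{I \<in> nsets (V - T) k. C (T \<union> I)}. \<Prod>i\<in>I. x i) powr p = 0"
        by simp
    qed
  qed (use V U in \<open>auto simp: finite_imp_finite_nsets nsets_mono\<close>)
  also have "\<dots> = wnorm (\<lambda>_. True) t k p U x"
    unfolding wnorm_def by (intro sum.cong refl, subst inner) (auto simp: nsets_def)
  finally show ?thesis .
qed

lemma wnorm_complete_reindex:
  assumes h: "inj_on h U"
  shows "wnorm (\<lambda>_. True) t k p (h ` U) y = wnorm (\<lambda>_. True) t k p U (\<lambda>i. y (h i))"
proof -
  have prod: "(\<Prod>i\<in>h ` S. y i) = (\<Prod>i\<in>S. y (h i))" if "S \<subseteq> U" for S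
    using inj_on_subset[OF h that] by (simp add: prod.reindex)
  have inner: "(\<Sum>I\<in>nsets (h ` U - h ` T) k. \<Prod>i\<in>I. y i) = (\<Sum>I\<in>nsets (U - T) k. \<Prod>i\<in>I. y (h i))"
    if "T \<subseteq> U" for T
  proof -
    have "bij_betw h (U - T) (h ` U - h ` T)"
      using h that by (auto simp: bij_betw_def inj_on_image_set_diff inj_on_diff)
    then have "bij_betw ((`) h) (nsets (U - T) k) (nsets (h ` U - h ` T) k)"
      by (rule bij_betw_nsets)
    then show ?thesis
      by (subst sum.reindex_bij_betw[symmetric]) (auto simp: nsets_def prod subset_iff intro!: sum.cong prod)
  qed
  have "bij_betw ((`) h) (nsets U t) (nsets (h ` U) t)"
    using h by (intro bij_betw_nsets) (simp add: bij_betw_def)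
  then show ?thesis
    unfolding wnorm_def
    by (subst sum.reindex_bij_betw[symmetric], assumption)
      (intro sum.cong refl arg_cong2[where f = "(*)"] arg_cong2[where f = "(powr)"];
       auto simp: nsets_def prod inner[unfolded nsets_def])
qed

text \<open>The clique on which the weight ends up may have fewer than l vertices. It is injected
  into {1..l}, and the points outside the image get weight 0, so the bound on the simplex
  applies.\<close>

lemma wnorm_complete_le_simplex:
  assumes U: "finite U" "card U \<le> l" and x: "\<And>i. i \<in> U \<Longrightarrow> 0 \<le> x i" "(\<Sum>i\<in>U. x i) = 1"
    and \<Lambda>: "\<And>y. y \<in> std_simplex {1..l} \<Longrightarrow> wnorm (\<lambda>_. True) t k p {1..l} y \<le> \<Lambda>"
  shows "wnorm (\<lambda>_. True) t k p U x \<le> \<Lambda>"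
proof -
  have "card U \<le> card {1..l}" using U by simp
  then obtain h where h: "inj_on h U" "h ` U \<subseteq> {1..l}"
    using card_le_inj[of U "{1..l}"] U by auto
  define y where "y j = (if j \<in> h ` U then x (inv_into U h j) else 0)" for j
  have yh: "y (h i) = x i" if "i \<in> U" for i using that h by (simp add: y_def)
  have "(\<Sum>j\<in>{1..l}. y j) = (\<Sum>j\<in>h ` U. y j)"
    using h by (intro sum.mono_neutral_right) (auto simp: y_def)
  also have "\<dots> = 1" using x(2) yh h(1) by (simp add: sum.reindex)
  finally have "y \<in> std_simplex {1..l}"
    using x(1) h yh by (auto simp: std_simplex_def y_def inv_into_into)
  then have "wnorm (\<lambda>_. True) t k p {1..l} y \<le> \<Lambda>" by (rule \<Lambda>)
  also have "wnorm (\<lambda>_. True) t k p {1..l} y = wnorm (\<lambda>_. True) t k p (h ` U) y"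
    using h by (intro wnorm_restrict_support) (auto simp: y_def)
  also have "\<dots> = wnorm (\<lambda>_. True) t k p U (\<lambda>i. y (h i))"
    using h(1) by (rule wnorm_complete_reindex)
  also have "\<dots> = wnorm (\<lambda>_. True) t k p U x"
    unfolding wnorm_def
    by (intro sum.cong refl arg_cong2[where f = "(*)"] arg_cong2[where f = "(powr)"] prod.cong)
      (auto simp: nsets_def yh subset_iff)
  finally show ?thesis .
qed

text \<open>The vector \<open>x\<close> is a convex combination of the two ends. As no counted set
  contains both u and v, each product is affine on this segment, and in each summand at most one of
  the two factors varies. A summand is thus affine, or a nonnegative constant times the p-th power
  of an affine function, and a convex function is at most its larger end value.\<close>

lemma wnorm_symmetrize:
  fixes x :: "'a \<Rightarrow> real"
  assumes V: "finite V" and x: "\<And>i. i \<in> V \<Longrightarrow> 0 \<le> x i" and p: "p \<ge> 1"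
    and uv: "u \<noteq> v" "x u > 0" "x v > 0"
    and C: "\<And>S. u \<in> S \<Longrightarrow> v \<in> S \<Longrightarrow> \<not> C S"
  defines "s \<equiv> x u + x v"
  shows "wnorm C t k p V x \<le> max (wnorm C t k p V (x(u := s, v := 0))) (wnorm C t k p V (x(u := 0, v := s)))"
    (is "_ \<le> max (wnorm C t k p V ?y) (wnorm C t k p V ?z)")
proof -
  define \<alpha> where "\<alpha> = x u / s"
  have s: "s > 0" using uv by (simp add: s_def)
  have \<alpha>: "0 < \<alpha>" "\<alpha> < 1" "1 - \<alpha> = x v / s" using uv s by (auto simp: \<alpha>_def s_def field_simps)
  have const: "(\<Prod>i\<in>S. ?y i) = (\<Prod>i\<in>S. x i)" "(\<Prod>i\<in>S. ?z i) = (\<Prod>i\<in>S. x i)"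
    if "u \<notin> S" "v \<notin> S" for S
    using that by (auto intro!: prod.cong)
  have conv: "(\<alpha> * a + (1 - \<alpha>) * b) powr p \<le> \<alpha> * a powr p + (1 - \<alpha>) * b powr p"
    if "0 \<le> a" "0 \<le> b" for a b
    using convex_onD[OF powr_convex_nonneg[OF p], of "1 - \<alpha>" a b] that \<alpha>(1,2) by simp
  have affine: "(\<Prod>i\<in>S. x i) = \<alpha> * (\<Prod>i\<in>S. ?y i) + (1 - \<alpha>) * (\<Prod>i\<in>S. ?z i)"
    if S: "finite S" "\<not> (u \<in> S \<and> v \<in> S)" for S
  proof -
    consider "u \<in> S" "v \<notin> S" | "u \<notin> S" "v \<in> S" | "u \<notin> S" "v \<notin> S" using S(2) by blast
    then show ?thesis
    proof cases
      case 1
      then have "(\<Prod>i\<in>S - {u}. ?y i) = (\<Prod>i\<in>S - {u}. x i)" by (intro prod.cong) auto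
      then show ?thesis
        using 1 that(1) uv(1) s by (simp add: prod.remove[of S u] \<alpha>_def)
    next
      case 2
      then have "(\<Prod>i\<in>S - {v}. ?z i) = (\<Prod>i\<in>S - {v}. x i)" by (intro prod.cong) auto
      then show ?thesis
        using 2 that(1) uv(1) s by (simp add: prod.remove[of S v] \<alpha>(3))
    next
      case 3
      then show ?thesis using const[of S] by (simp add: algebra_simps)
    qed
  qed
  have y: "0 \<le> ?y i" "0 \<le> ?z i" if "i \<in> V" for i using x[OF that] s by auto
  let ?W = "\<lambda>T. {I \<in> nsets (V - T) k. C (T \<union> I)}"
  let ?f = "\<lambda>x T. (\<Prod>i\<in>T. x i) * (\<Sum>I\<in>?W T. \<Prod>i\<in>I. x i) powr p"
  have summand: "?f x T \<le> \<alpha> * ?f ?y T + (1 - \<alpha>) * ?f ?z T" if T: "T \<in> nsets V t" for T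
  proof -
    have T': "T \<subseteq> V" "finite T" using T by (auto simp: nsets_def)
    have WI: "finite I \<and> I \<subseteq> V \<and> I \<inter> T = {} \<and> \<not> (u \<in> T \<union> I \<and> v \<in> T \<union> I)" if "I \<in> ?W T" for I
      using that C[of "T \<union> I"] by (auto simp: nsets_def)
    consider "u \<in> T" "v \<in> T" | "u \<notin> T" "v \<notin> T" | "\<not> (u \<in> T \<and> v \<in> T)" "u \<in> T \<or> v \<in> T" by blast
    then show ?thesis
    proof cases
      case 1
      then have W: "?W T = {}" using C by blast
      show ?thesis unfolding W by simp
    next
      case 2
      have sy: "0 \<le> (\<Sum>I\<in>?W T. \<Prod>i\<in>I. ?y i)" and sz: "0 \<le> (\<Sum>I\<in>?W T. \<Prod>i\<in>I. ?z i)"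
        using WI y by (intro sum_nonneg prod_nonneg; blast)+
      have "(\<Sum>I\<in>?W T. \<Prod>i\<in>I. x i) = (\<Sum>I\<in>?W T. \<alpha> * (\<Prod>i\<in>I. ?y i) + (1 - \<alpha>) * (\<Prod>i\<in>I. ?z i))"
        using WI by (intro sum.cong refl affine) auto
      also have "\<dots> = \<alpha> * (\<Sum>I\<in>?W T. \<Prod>i\<in>I. ?y i) + (1 - \<alpha>) * (\<Sum>I\<in>?W T. \<Prod>i\<in>I. ?z i)"
        by (simp only: sum.distrib sum_distrib_left)
      finally have "(\<Sum>I\<in>?W T. \<Prod>i\<in>I. x i) powr p
          \<le> \<alpha> * (\<Sum>I\<in>?W T. \<Prod>i\<in>I. ?y i) powr p + (1 - \<alpha>) * (\<Sum>I\<in>?W T. \<Prod>i\<in>I. ?z i) powr p"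
        using conv[OF sy sz] by (simp only:)
      moreover have "0 \<le> (\<Prod>i\<in>T. x i)" using T' x by (intro prod_nonneg) blast
      ultimately have "?f x T \<le> (\<Prod>i\<in>T. x i) * (\<alpha> * (\<Sum>I\<in>?W T. \<Prod>i\<in>I. ?y i) powr p
          + (1 - \<alpha>) * (\<Sum>I\<in>?W T. \<Prod>i\<in>I. ?z i) powr p)"
        by (rule mult_left_mono)
      then show ?thesis unfolding const[OF 2] by (simp only: distrib_left mult.left_commute)
    next
      case 3
      \<comment> \<open>T already contains u or v, so an admissible I contains neither: only the
        outer product varies, and equality holds.\<close>
      have c: "(\<Prod>i\<in>I. ?y i) = (\<Prod>i\<in>I. x i)" "(\<Prod>i\<in>I. ?z i) = (\<Prod>i\<in>I. x i)" if "I \<in> ?W T" for I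
        using WI[OF that] 3 by (intro const; blast)+
      have "(\<Sum>I\<in>?W T. \<Prod>i\<in>I. ?y i) = (\<Sum>I\<in>?W T. \<Prod>i\<in>I. x i)"
        "(\<Sum>I\<in>?W T. \<Prod>i\<in>I. ?z i) = (\<Sum>I\<in>?W T. \<Prod>i\<in>I. x i)"
        using c by (intro sum.cong refl; blast)+
      then show ?thesis
        using affine[OF T'(2) 3(1)] by (simp only: distrib_right mult.assoc order_refl)
    qed
  qed
  have "wnorm C t k p V x \<le> (\<Sum>T\<in>nsets V t. \<alpha> * ?f ?y T + (1 - \<alpha>) * ?f ?z T)"
    unfolding wnorm_def by (intro sum_mono summand)
  also have "\<dots> = \<alpha> * wnorm C t k p V ?y + (1 - \<alpha>) * wnorm C t k p V ?z"
    unfolding wnorm_def by (simp only: sum.distrib sum_distrib_left)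
  also have "\<dots> \<le> max (wnorm C t k p V ?y) (wnorm C t k p V ?z)"
    using \<alpha> by (intro convex_bound_le) auto
  finally show ?thesis .
qed

lemma sum_move_mass:
  fixes x :: "'a \<Rightarrow> 'b::comm_monoid_add"
  assumes "finite V" "a \<in> V" "b \<in> V" "a \<noteq> b"
  shows "(\<Sum>i\<in>V. (x(a := x a + x b, b := 0)) i) = (\<Sum>i\<in>V. x i)"
proof -
  have V: "V = insert a (insert b (V - {a, b}))" using assms by auto
  have "(\<Sum>i\<in>V - {a, b}. (x(a := x a + x b, b := 0)) i) = (\<Sum>i\<in>V - {a, b}. x i)"
    by (intro sum.cong) auto
  then show ?thesis
    using assms by (subst (1 2) V) (simp add: add.assoc)
qed

text \<open>Induction on the size of the support: while it contains two nonadjacent vertices, one of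
  them can be emptied. In the end the support is a clique, of size at most l because there is no
  clique of size l + 1.\<close>

lemma wnorm_clique_le:
  fixes x :: "'a \<Rightarrow> real"
  assumes V: "finite V" and p: "p \<ge> 1"
    and sym: "\<And>a b. E a b \<Longrightarrow> E b a"
    and free: "\<And>S. S \<in> nsets V (l + 1) \<Longrightarrow> \<not> clique E S"
    and \<Lambda>: "\<And>y. y \<in> std_simplex {1..l} \<Longrightarrow> wnorm (\<lambda>_. True) t k p {1..l} y \<le> \<Lambda>"
    and x: "\<And>i. i \<in> V \<Longrightarrow> 0 \<le> x i" "(\<Sum>i\<in>V. x i) = 1"
  shows "wnorm (clique E) t k p V x \<le> \<Lambda>"
  using x
proof (induction "card {i \<in> V. x i \<noteq> 0}" arbitrary: x rule: less_induct)
  case less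
  let ?U = "{i \<in> V. x i \<noteq> 0}"
  show ?case
  proof (cases "clique E ?U")
    case True
    have small: "card ?U \<le> l"
    proof (rule ccontr)
      assume "\<not> card ?U \<le> l"
      then have "l + 1 \<le> card ?U" by simp
      then obtain S where "S \<subseteq> ?U" "card S = l + 1" "finite S"
        by (rule obtain_subset_with_card_n)
      then show False
        using free[of S] True clique_mono[OF True] by (auto simp: nsets_def)
    qed
    have "(\<Sum>i\<in>?U. x i) = (\<Sum>i\<in>V. x i)"
      by (rule sum.mono_neutral_left[OF V]) simp_all
    then have "(\<Sum>i\<in>?U. x i) = 1" by (simp only: less.prems(2))
    then have "wnorm (\<lambda>_. True) t k p ?U x \<le> \<Lambda>"
      using V less.prems(1) by (intro wnorm_complete_le_simplex[OF _ small _ _ \<Lambda>]) auto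
    also have "wnorm (\<lambda>_. True) t k p ?U x = wnorm (clique E) t k p V x"
      using V True by (intro wnorm_restrict_support[symmetric]) (auto intro: clique_mono)
    finally show ?thesis .
  next
    case False
    then obtain u v where uv: "u \<in> ?U" "v \<in> ?U" "u \<noteq> v" "\<not> E u v" by (auto simp: clique_def)
    let ?s = "x u + x v"
    have pos: "x u > 0" "x v > 0" using uv less.prems(1) by (auto simp: less_le)
    have sum: "(\<Sum>i\<in>V. (x(a := ?s, b := 0)) i) = 1" if "a = u \<and> b = v \<or> a = v \<and> b = u" for a b
    proof -
      have "x(a := ?s, b := 0) = x(a := x a + x b, b := 0)" using that by (auto simp: add.commute)
      moreover have "a \<in> V" "b \<in> V" "a \<noteq> b" using that uv by auto
      ultimately show ?thesis using sum_move_mass[OF V, of a b x] less.prems(2) by metis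
    qed
    have dec: "wnorm (clique E) t k p V (x(a := ?s, b := 0)) \<le> \<Lambda>" if "a = u \<and> b = v \<or> a = v \<and> b = u" for a b
    proof (rule less.hyps)
      have "a \<in> ?U" "b \<in> ?U" "a \<noteq> b" using that uv(1-3) by blast+
      then have "{i \<in> V. (x(a := ?s, b := 0)) i \<noteq> 0} \<subseteq> ?U - {b}" "?U - {b} \<subset> ?U"
        by (auto split: if_splits)
      then have "{i \<in> V. (x(a := ?s, b := 0)) i \<noteq> 0} \<subset> ?U" by (rule subset_psubset_trans)
      then show "card {i \<in> V. (x(a := ?s, b := 0)) i \<noteq> 0} < card ?U"
        by (rule psubset_card_mono[rotated]) (simp add: V)
      show "0 \<le> (x(a := ?s, b := 0)) i" if "i \<in> V" for i
        using less.prems(1)[OF that] pos by simp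
    qed (rule sum[OF that])
    have "wnorm (clique E) t k p V x \<le> max (wnorm (clique E) t k p V (x(u := ?s, v := 0)))
        (wnorm (clique E) t k p V (x(u := 0, v := ?s)))"
    proof (rule wnorm_symmetrize)
      show "\<not> clique E S" if "u \<in> S" "v \<in> S" for S
        using that uv(3,4) by (auto simp: clique_def)
    qed (use V less.prems(1) p uv(3) pos in auto)
    also have "x(u := 0, v := ?s) = x(v := ?s, u := 0)"
      using uv(3) by (rule fun_upd_twist)
    also have "max (wnorm (clique E) t k p V (x(u := ?s, v := 0)))
        (wnorm (clique E) t k p V (x(v := ?s, u := 0))) \<le> \<Lambda>"
      by (intro max.boundedI dec) simp_all
    finally show ?thesis .
  qed
qed

section \<open>Maclaurin's inequality\<close>

lemma nsets_insert_Suc: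
  assumes "u \<notin> W" "finite W"
  shows "nsets (insert u W) (Suc k) = nsets W (Suc k) \<union> insert u ` nsets W k"
proof (intro equalityI subsetI)
  fix S assume S: "S \<in> nsets (insert u W) (Suc k)"
  show "S \<in> nsets W (Suc k) \<union> insert u ` nsets W k"
  proof (cases "u \<in> S")
    case True
    then have "S - {u} \<in> nsets W k" "S = insert u (S - {u})" using S by (auto simp: nsets_def)
    then show ?thesis by blast
  next
    case False
    then show ?thesis using S by (auto simp: nsets_def)
  qed
next
  fix S assume "S \<in> nsets W (Suc k) \<union> insert u ` nsets W k"
  moreover have "insert u T \<in> nsets (insert u W) (Suc k)" if "T \<in> nsets W k" for T
  proof -
    have "u \<notin> T" "finite T" "T \<subseteq> W" "card T = k" using that assms by (auto simp: nsets_def)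
    then show ?thesis by (auto simp: nsets_def)
  qed
  ultimately show "S \<in> nsets (insert u W) (Suc k)" using nsets_mono[of W "insert u W" "Suc k"] by blast
qed

lemma sum_prod_nsets_insert:
  fixes x :: "'a \<Rightarrow> real"
  assumes W: "u \<notin> W" "finite W"
  shows "(\<Sum>I\<in>nsets (insert u W) (Suc k). \<Prod>i\<in>I. x i)
    = (\<Sum>I\<in>nsets W (Suc k). \<Prod>i\<in>I. x i) + x u * (\<Sum>I\<in>nsets W k. \<Prod>i\<in>I. x i)"
proof -
  have inj: "inj_on (insert u) (nsets W k)"
    using W by (intro inj_onI) (auto simp: nsets_def dest!: insert_ident[THEN iffD1, rotated 2])
  have "(\<Sum>I\<in>insert u ` nsets W k. \<Prod>i\<in>I. x i) = (\<Sum>I\<in>nsets W k. x u * (\<Prod>i\<in>I. x i))"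
    using W by (simp add: sum.reindex[OF inj]) (intro sum.cong refl prod.insert; auto simp: nsets_def)
  moreover have "nsets W (Suc k) \<inter> insert u ` nsets W k = {}" using W by (auto simp: nsets_def)
  ultimately show ?thesis
    using W by (simp add: nsets_insert_Suc sum.union_disjoint finite_imp_finite_nsets sum_distrib_left)
qed

text \<open>With u and v singled out, the sum is e_k + (x u + x v) e_(k-1) + x u x v e_(k-2), where
  the e_j are the elementary symmetric sums of the other variables. The first two terms are
  unchanged and the third can only grow.\<close>

lemma sum_prod_nsets_mono_balance:
  fixes x x' :: "'a \<Rightarrow> real"
  assumes V: "finite V" "u \<in> V" "v \<in> V" "u \<noteq> v"
    and x: "\<And>i. i \<in> V \<Longrightarrow> 0 \<le> x i" and eq: "\<And>i. i \<in> V - {u, v} \<Longrightarrow> x' i = x i"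
    and sum: "x' u + x' v = x u + x v" and le: "x u * x v \<le> x' u * x' v"
  shows "(\<Sum>I\<in>nsets V k. \<Prod>i\<in>I. x i) \<le> (\<Sum>I\<in>nsets V k. \<Prod>i\<in>I. x' i)"
proof -
  let ?W = "V - {u, v}"
  let ?e = "\<lambda>k x. \<Sum>I\<in>nsets ?W k. \<Prod>i\<in>I. x i"
  have W: "V = insert u (insert v ?W)" "finite ?W" using V by auto
  have e: "?e k x' = ?e k x" for k
    using eq by (intro sum.cong refl prod.cong) (auto simp: nsets_def)
  have exp: "(\<Sum>I\<in>nsets V (Suc (Suc k)). \<Prod>i\<in>I. y i) =
      ?e (Suc (Suc k)) y + (y u + y v) * ?e (Suc k) y + y u * y v * ?e k y" for y :: "'a \<Rightarrow> real" and k
    using V by (subst W(1)) (simp add: sum_prod_nsets_insert algebra_simps)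
  have exp1: "(\<Sum>I\<in>nsets V (Suc 0). \<Prod>i\<in>I. y i) = ?e (Suc 0) y + (y u + y v)" for y :: "'a \<Rightarrow> real"
    using V by (subst W(1)) (simp add: sum_prod_nsets_insert algebra_simps)
  consider "k = 0" | "k = Suc 0" | k' where "k = Suc (Suc k')" by (metis old.nat.exhaust)
  then show ?thesis
  proof cases
    case 2
    show ?thesis unfolding 2 exp1 e sum ..
  next
    case 3
    have "0 \<le> ?e k' x" using x by (intro sum_nonneg prod_nonneg) (auto simp: nsets_def)
    then show ?thesis unfolding 3 exp e sum using le by (simp add: mult_right_mono)
  qed simp
qed

text \<open>One coordinate below the mean is raised to the mean at the expense of one above it. This
  balances the pair and lowers the number of coordinates that differ from the mean.\<close>

lemma maclaurin_sum_prod_nsets: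
  fixes x :: "'a \<Rightarrow> real"
  assumes V: "finite V" "V \<noteq> {}" and x: "\<And>i. i \<in> V \<Longrightarrow> 0 \<le> x i" "(\<Sum>i\<in>V. x i) = 1"
  shows "(\<Sum>I\<in>nsets V k. \<Prod>i\<in>I. x i) \<le> real (card V choose k) * (1 / real (card V)) ^ k"
  using x
proof (induction "card {i \<in> V. x i \<noteq> 1 / real (card V)}" arbitrary: x rule: less_induct)
  case less
  define c where "c = 1 / real (card V)"
  have c: "(\<Sum>i\<in>V. c) = 1" "c > 0" using V by (auto simp: c_def card_gt_0_iff)
  show ?case
  proof (cases "\<forall>i\<in>V. x i = c")
    case True
    then have "(\<Sum>I\<in>nsets V k. \<Prod>i\<in>I. x i) = (\<Sum>I\<in>nsets V k. c ^ k)"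
      by (intro sum.cong refl) (auto simp: nsets_def subset_iff)
    also have "\<dots> = real (card V choose k) * c ^ k" using V by (simp add: nsets_choose)
    finally show ?thesis by (simp add: c_def)
  next
    case False
    have "\<exists>u\<in>V. x u < c"
    proof (rule ccontr)
      assume no_u: "\<not> (\<exists>u\<in>V. x u < c)"
      then have "(\<Sum>i\<in>V. c) < (\<Sum>i\<in>V. x i)"
        proof (intro sum_strict_mono_ex1 V)
        show le: "\<forall>i\<in>V. c \<le> x i" using no_u by (simp add: not_less)
        show "\<exists>i\<in>V. c < x i" using False le by force
      qed
      then show False using c less.prems(2) by simp
    qed
    then obtain u where u: "u \<in> V" "x u < c" by blast
    have "\<exists>v\<in>V. c < x v"
    proof (rule ccontr)
      assume no_v: "\<not> (\<exists>v\<in>V. c < x v)"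
      then have "(\<Sum>i\<in>V. x i) < (\<Sum>i\<in>V. c)"
        proof (intro sum_strict_mono_ex1 V)
        show le: "\<forall>i\<in>V. x i \<le> c" using no_v by (simp add: not_less)
        show "\<exists>i\<in>V. x i < c" using False le by force
      qed
      then show False using c less.prems(2) by simp
    qed
    then obtain v where v: "v \<in> V" "c < x v" by blast
    have uv: "u \<noteq> v" using u v by auto
    define y where "y = x(u := c, v := x u + x v - c)"
    have yu: "y u = c" and yv: "y v = x u + x v - c" and y: "\<And>i. i \<noteq> u \<Longrightarrow> i \<noteq> v \<Longrightarrow> y i = x i"
      using uv by (auto simp: y_def)
    have "(\<Sum>I\<in>nsets V k. \<Prod>i\<in>I. x i) \<le> (\<Sum>I\<in>nsets V k. \<Prod>i\<in>I. y i)"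
    proof (rule sum_prod_nsets_mono_balance[OF V(1) u(1) v(1) uv less.prems(1)])
      \<comment> \<open>The mean c lies strictly between \<open>x u\<close> and \<open>x v\<close>,
        so both factors are positive.\<close>
      have "y u * y v - x u * x v = (c - x u) * (x v - c)" by (simp add: yu yv algebra_simps)
      also have "\<dots> \<ge> 0" using u v by simp
      finally show "x u * x v \<le> y u * y v" by simp
    qed (auto simp: yu yv y)
    also have "\<dots> \<le> real (card V choose k) * (1 / real (card V)) ^ k"
    proof (rule less.hyps)
      \<comment> \<open>The vertex v already differed from c, so whether its new value equals c
        makes no difference to the inclusion.\<close>
      have "{i \<in> V. y i \<noteq> c} \<subseteq> {i \<in> V. x i \<noteq> c} - {u}"
        using yu y v by (auto, metis less_irrefl)
      moreover have "{i \<in> V. x i \<noteq> c} - {u} \<subset> {i \<in> V. x i \<noteq> c}" using u by auto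
      ultimately have "{i \<in> V. y i \<noteq> c} \<subset> {i \<in> V. x i \<noteq> c}" by (rule subset_psubset_trans)
      then have "card {i \<in> V. y i \<noteq> c} < card {i \<in> V. x i \<noteq> c}"
        by (rule psubset_card_mono[rotated]) (simp add: V)
      then show "card {i \<in> V. y i \<noteq> 1 / real (card V)} < card {i \<in> V. x i \<noteq> 1 / real (card V)}"
        by (simp only: c_def)
      show "0 \<le> y i" if "i \<in> V" for i
      proof (cases "i = u \<or> i = v")
        case True
        then show ?thesis using yu yv c(2) v(2) less.prems(1)[OF u(1)] by auto
      next
        case False
        then show ?thesis using y less.prems(1)[OF that] by auto
      qed
      have V': "V = insert u (insert v (V - {u, v}))" using u v by auto
      have "(\<Sum>i\<in>V. y i) = y u + (y v + (\<Sum>i\<in>V - {u, v}. y i))"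
        using V uv by (subst V') simp
      also have "(\<Sum>i\<in>V - {u, v}. y i) = (\<Sum>i\<in>V - {u, v}. x i)" using y by (intro sum.cong) auto
      also have "y u + (y v + (\<Sum>i\<in>V - {u, v}. x i)) = x u + (x v + (\<Sum>i\<in>V - {u, v}. x i))"
        by (simp add: yu yv)
      also have "\<dots> = (\<Sum>i\<in>V. x i)" using V uv by (subst (2) V') simp
      finally show "(\<Sum>i\<in>V. y i) = 1" by (simp only: less.prems(2))
    qed
    finally show ?thesis .
  qed
qed

text \<open>For t = 0 only T = {} occurs. Clique counts are thus norms with p = 1, and the bounds
  for p >= 1 apply to them; the case p < 1 rests on this.\<close>

lemma wnorm_edge_count:
  "wnorm C 0 k 1 V (\<lambda>_. 1) = real (card {I \<in> nsets V k. C I})"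
  by (simp add: wnorm_def)

lemma wnorm_edges_simplex_le:
  assumes "l \<ge> 1" "y \<in> std_simplex {1..l}"
  shows "wnorm (\<lambda>_. True) 0 k 1 {1..l} y \<le> real (l choose k) * (1 / real l) ^ k"
proof -
  have "0 \<le> (\<Sum>I\<in>nsets {1..l} k. \<Prod>i\<in>I. y i)"
    using assms by (intro sum_nonneg prod_nonneg) (auto simp: nsets_def std_simplex_def subset_iff)
  then have "wnorm (\<lambda>_. True) 0 k 1 {1..l} y = (\<Sum>I\<in>nsets {1..l} k. \<Prod>i\<in>I. y i)"
    by (simp add: wnorm_def)
  then show ?thesis
    using maclaurin_sum_prod_nsets[of "{1..l}" y k] assms by (auto simp: std_simplex_def)
qed

section \<open>Sampling\<close>

lemma card_nsets_supersets:
  assumes V: "finite V" "T \<subseteq> V" "card T \<le> m"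
  shows "card {S \<in> nsets V m. T \<subseteq> S} = (card V - card T) choose (m - card T)"
proof -
  have T: "finite T" using V finite_subset by blast
  have "bij_betw (\<lambda>R. T \<union> R) (nsets (V - T) (m - card T)) {S \<in> nsets V m. T \<subseteq> S}"
  proof (rule bij_betw_byWitness[where f' = "\<lambda>S. S - T"])
    show "(\<lambda>R. T \<union> R) ` nsets (V - T) (m - card T) \<subseteq> {S \<in> nsets V m. T \<subseteq> S}"
    proof
      fix S assume "S \<in> (\<lambda>R. T \<union> R) ` nsets (V - T) (m - card T)"
      then obtain R where R: "S = T \<union> R" "R \<subseteq> V - T" "finite R" "card R = m - card T"
        by (auto simp: nsets_def)
      then have "card S = m" using T V(3) card_Un_disjoint[of T R] by auto
      then show "S \<in> {S \<in> nsets V m. T \<subseteq> S}" using R V T by (auto simp: nsets_def)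
    qed
    show "(\<lambda>S. S - T) ` {S \<in> nsets V m. T \<subseteq> S} \<subseteq> nsets (V - T) (m - card T)"
      using T by (auto simp: nsets_def card_Diff_subset)
  qed (auto simp: nsets_def)
  then have "card {S \<in> nsets V m. T \<subseteq> S} = card (nsets (V - T) (m - card T))"
    by (rule bij_betw_same_card[symmetric])
  then show ?thesis using V T by (simp add: nsets_choose card_Diff_subset)
qed

text \<open>Double counting of the pairs (S, I) with T \<union> I inside the m-set S: every I
  counted on the right lies in the same number of sets S.\<close>

lemma sum_codeg_nsets:
  assumes V: "finite V" and T: "T \<in> nsets V t" and m: "t + k \<le> m"
  shows "(\<Sum>S | S \<in> nsets V m \<and> T \<subseteq> S. codeg C k S T)
    = codeg C k V T * ((card V - (t + k)) choose (m - (t + k)))"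
proof -
  let ?SS = "{S \<in> nsets V m. T \<subseteq> S}"
  let ?W = "{I \<in> nsets (V - T) k. C (T \<union> I)}"
  have fin: "finite ?SS" "finite ?W" using V by (auto simp: finite_imp_finite_nsets)
  have "(\<Sum>S\<in>?SS. codeg C k S T) = (\<Sum>S\<in>?SS. \<Sum>I | I \<in> ?W \<and> I \<subseteq> S. 1)"
  proof (rule sum.cong[OF refl])
    fix S assume "S \<in> ?SS"
    then have "{I \<in> nsets (S - T) k. C (T \<union> I)} = {I. I \<in> ?W \<and> I \<subseteq> S}"
      by (auto simp: nsets_def)
    then show "codeg C k S T = (\<Sum>I | I \<in> ?W \<and> I \<subseteq> S. 1)" by (simp add: codeg_def)
  qed
  also have "\<dots> = (\<Sum>I\<in>?W. \<Sum>S | S \<in> ?SS \<and> I \<subseteq> S. 1)"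
    by (rule sum.swap_restrict[OF fin])
  also have "\<dots> = (\<Sum>I\<in>?W. (card V - (t + k)) choose (m - (t + k)))"
  proof (rule sum.cong[OF refl])
    fix I assume I: "I \<in> ?W"
    then have "T \<inter> I = {}" "finite T" "finite I" "card T = t" "card I = k" "T \<union> I \<subseteq> V"
      using T by (auto simp: nsets_def)
    then have "card (T \<union> I) = t + k" "T \<union> I \<subseteq> V" by (auto simp: card_Un_disjoint)
    moreover have "{S. S \<in> ?SS \<and> I \<subseteq> S} = {S \<in> nsets V m. T \<union> I \<subseteq> S}" by auto
    ultimately show "(\<Sum>S | S \<in> ?SS \<and> I \<subseteq> S. 1) = (card V - (t + k)) choose (m - (t + k))"
      using card_nsets_supersets[OF V, of "T \<union> I" m] m by simp
  qed
  also have "\<dots> = codeg C k V T * ((card V - (t + k)) choose (m - (t + k)))"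
    by (simp add: codeg_def)
  finally show ?thesis .
qed

text \<open>For fixed T, the codegree in V times the number of m-sets over a given T \<union> I is
  the sum of the codegrees in the m-sets S over T. The power mean inequality moves the exponent
  inside this sum, which is where p >= 1 enters; then the sums over T and S are exchanged.\<close>

lemma wnorm_sampling:
  assumes V: "finite V" and p: "p \<ge> 1" and m: "t + k \<le> m" "m \<le> card V"
  shows "wnorm C t k p V (\<lambda>_. 1) * real ((card V - (t + k)) choose (m - (t + k))) powr p
    \<le> real ((card V - t) choose (m - t)) powr (p - 1) * (\<Sum>S\<in>nsets V m. wnorm C t k p S (\<lambda>_. 1))"
proof -
  let ?B = "real ((card V - t) choose (m - t))"
  let ?R = "real ((card V - (t + k)) choose (m - (t + k)))"
  have fin: "finite (nsets V m)" "finite (nsets V t)" using V by (auto simp: finite_imp_finite_nsets)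
  have "wnorm C t k p V (\<lambda>_. 1) * ?R powr p = (\<Sum>T\<in>nsets V t. (real (codeg C k V T) * ?R) powr p)"
    by (simp add: wnorm_one sum_distrib_right powr_mult)
  also have "\<dots> \<le> (\<Sum>T\<in>nsets V t. ?B powr (p - 1) * (\<Sum>S | S \<in> nsets V m \<and> T \<subseteq> S. real (codeg C k S T) powr p))"
  proof (rule sum_mono)
    fix T assume T: "T \<in> nsets V t"
    let ?SS = "{S. S \<in> nsets V m \<and> T \<subseteq> S}"
    have "real (codeg C k V T) * ?R = (\<Sum>S\<in>?SS. real (codeg C k S T))"
      using sum_codeg_nsets[OF V T m(1), of C] by (simp flip: of_nat_sum of_nat_mult)
    moreover have "card ?SS = (card V - t) choose (m - t)"
      using card_nsets_supersets[OF V, of T m] T m by (auto simp: nsets_def)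
    moreover have "finite ?SS" using fin by simp
    ultimately show "(real (codeg C k V T) * ?R) powr p
        \<le> ?B powr (p - 1) * (\<Sum>S\<in>?SS. real (codeg C k S T) powr p)"
      using sum_powr_power_mean[OF p, of ?SS "\<lambda>S. real (codeg C k S T)"] by simp
  qed
  also have "\<dots> = ?B powr (p - 1) * (\<Sum>S\<in>nsets V m. \<Sum>T | T \<in> nsets V t \<and> T \<subseteq> S. real (codeg C k S T) powr p)"
    by (simp only: sum.swap_restrict[OF fin] flip: sum_distrib_left)
  also have "(\<Sum>S\<in>nsets V m. \<Sum>T | T \<in> nsets V t \<and> T \<subseteq> S. real (codeg C k S T) powr p)
      = (\<Sum>S\<in>nsets V m. wnorm C t k p S (\<lambda>_. 1))"
  proof (rule sum.cong[OF refl])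
    fix S assume "S \<in> nsets V m"
    then have "{T. T \<in> nsets V t \<and> T \<subseteq> S} = nsets S t" by (auto simp: nsets_def)
    then show "(\<Sum>T | T \<in> nsets V t \<and> T \<subseteq> S. real (codeg C k S T) powr p) = wnorm C t k p S (\<lambda>_. 1)"
      by (simp add: wnorm_one)
  qed
  finally show ?thesis .
qed

lemma wnorm_scale:
  assumes "c \<ge> 0"
  shows "wnorm C t k p V (\<lambda>i. c * x i) = c ^ t * (c ^ k) powr p * wnorm C t k p V x"
proof -
  have inner: "(\<Sum>I\<in>{I \<in> nsets (V - T) k. C (T \<union> I)}. \<Prod>i\<in>I. c * x i)
      = c ^ k * (\<Sum>I\<in>{I \<in> nsets (V - T) k. C (T \<union> I)}. \<Prod>i\<in>I. x i)" for T
    unfolding sum_distrib_left by (intro sum.cong refl) (auto simp: prod.distrib nsets_def)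
  have "(\<Prod>i\<in>T. c * x i) = c ^ t * (\<Prod>i\<in>T. x i)" if "T \<in> nsets V t" for T
    using that by (simp add: prod.distrib nsets_def)
  then show ?thesis
    unfolding wnorm_def inner powr_mult unfolding sum_distrib_left
    by (intro sum.cong refl) (simp only: mult.assoc mult.left_commute)
qed

lemma choose_le_power: "(n choose k) \<le> n ^ k"
  by (cases "k \<le> n") (simp_all add: binomial_le_pow binomial_eq_0)

lemma wnorm_one_le:
  assumes V: "finite V" and p: "p \<ge> 0"
  shows "wnorm C t k p V (\<lambda>_. 1) \<le> real (card V) ^ t * (real (card V) ^ k) powr p"
proof -
  have "codeg C k V T \<le> card V ^ k" for T
  proof -
    have "codeg C k V T \<le> card (nsets V k)"
      unfolding codeg_def using V by (intro card_mono) (auto simp: finite_imp_finite_nsets nsets_def)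
    then show ?thesis using V choose_le_power[of "card V" k] by (simp add: nsets_choose)
  qed
  then have "wnorm C t k p V (\<lambda>_. 1) \<le> (\<Sum>T\<in>nsets V t. (real (card V) ^ k) powr p)"
    unfolding wnorm_one using p by (intro sum_mono powr_mono2) (auto simp flip: of_nat_power)
  also have "\<dots> \<le> real (card V) ^ t * (real (card V) ^ k) powr p"
    using V choose_le_power[of "card V" t] by (simp add: nsets_choose mult_right_mono flip: of_nat_power)
  finally show ?thesis .
qed

text \<open>An m-set without (l + 1)-clique has norm at most D * \<Lambda>, by homogeneity and
  \<open>wnorm_clique_le\<close> at the weights 1 / m. Any other m-set is charged D for each of its
  (l + 1)-cliques. Averaging turns these charges into the clique density of E in V.\<close>

lemma wnorm_clique_sampling_le:
  fixes \<Lambda> :: real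
  assumes V: "finite V" and p: "p \<ge> 1" and m: "t + k \<le> m" "l + 1 \<le> m" "m \<le> card V"
    and sym: "\<And>a b. E a b \<Longrightarrow> E b a"
    and \<Lambda>: "\<And>y. y \<in> std_simplex {1..l} \<Longrightarrow> wnorm (\<lambda>_. True) t k p {1..l} y \<le> \<Lambda>" "\<Lambda> \<ge> 0"
  shows "wnorm (clique E) t k p V (\<lambda>_. 1) \<le>
    real (card V choose t) / real (m choose t) *
    (real ((card V - t) choose k) / real ((m - t) choose k)) powr p *
    (real m ^ t * (real m ^ k) powr p *
      (\<Lambda> + real (card {S \<in> nsets V (l + 1). clique E S}) *
         (real (m choose (l + 1)) / real (card V choose (l + 1)))))"
proof -
  define n where "n = card V"
  define q where "q = real (card {S \<in> nsets V (l + 1). clique E S})"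
  \<comment> \<open>Both the trivial bound of \<open>wnorm_one_le\<close> for an m-set and the
    factor that scales the weights 1 / m up to 1.\<close>
  define D where "D = real m ^ t * (real m ^ k) powr p"
  define A where "A = real (n choose m)"
  define B where "B = real ((n - t) choose (m - t))"
  define R where "R = real ((n - (t + k)) choose (m - (t + k)))"
  define L where "L = real ((n - (l + 1)) choose (m - (l + 1)))"
  have pos: "A > 0" "B > 0" "R > 0" "D \<ge> 0" using m by (auto simp: A_def B_def R_def D_def n_def)
  have m0: "m > 0" using m by simp
  have local: "wnorm (clique E) t k p S (\<lambda>_. 1) \<le> D * (\<Lambda> + real (card {C \<in> nsets S (l + 1). clique E C}))"
    if S: "S \<in> nsets V m" for S
  proof (cases "{C \<in> nsets S (l + 1). clique E C} = {}")
    case True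
    have S': "finite S" "card S = m" using S by (auto simp: nsets_def)
    have "wnorm (clique E) t k p S (\<lambda>_. 1 / real m) \<le> \<Lambda>"
      using S' True m0 by (intro wnorm_clique_le[OF _ p sym _ \<Lambda>(1)]) auto
    then have "D * ((1 / real m) ^ t * ((1 / real m) ^ k) powr p * wnorm (clique E) t k p S (\<lambda>_. 1)) \<le> D * \<Lambda>"
      using pos wnorm_scale[of "1 / real m" "clique E" t k p S "\<lambda>_. 1"] by (simp add: mult_left_mono)
    moreover have "D * ((1 / real m) ^ t * ((1 / real m) ^ k) powr p) = 1"
      using m0 by (simp add: D_def power_one_over powr_divide)
    ultimately show ?thesis unfolding True by (simp add: mult.assoc[symmetric])
  next
    case False
    have S': "finite S" "card S = m" using S by (auto simp: nsets_def)
    have "finite {C \<in> nsets S (l + 1). clique E C}" using S' by (simp add: finite_imp_finite_nsets)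
    then have "card {C \<in> nsets S (l + 1). clique E C} \<ge> 1" using False by (simp add: Suc_leI card_gt_0_iff)
    then have "1 \<le> \<Lambda> + real (card {C \<in> nsets S (l + 1). clique E C})" using \<Lambda>(2) by linarith
    then have "D * 1 \<le> D * (\<Lambda> + real (card {C \<in> nsets S (l + 1). clique E C}))"
      using pos by (intro mult_left_mono) auto
    moreover have "wnorm (clique E) t k p S (\<lambda>_. 1) \<le> D"
      using wnorm_one_le[OF S'(1), of p "clique E" t k] p S' by (simp add: D_def)
    ultimately show ?thesis by simp
  qed
  have "(\<Sum>S\<in>nsets V m. card {C \<in> nsets S (l + 1). clique E C})
      = codeg (clique E) (l + 1) V {} * ((n - (0 + (l + 1))) choose (m - (0 + (l + 1))))"
    using sum_codeg_nsets[of V "{}" 0 "l + 1" m "clique E"] V m by (simp add: codeg_def n_def)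
  then have count: "(\<Sum>S\<in>nsets V m. real (card {C \<in> nsets S (l + 1). clique E C})) = q * L"
    by (simp add: codeg_def q_def L_def flip: of_nat_sum of_nat_mult)
  have "wnorm (clique E) t k p V (\<lambda>_. 1) * R powr p
      \<le> B powr (p - 1) * (\<Sum>S\<in>nsets V m. wnorm (clique E) t k p S (\<lambda>_. 1))"
    using wnorm_sampling[OF V p m(1,3), of "clique E"] by (simp add: R_def B_def n_def)
  also have "(\<Sum>S\<in>nsets V m. wnorm (clique E) t k p S (\<lambda>_. 1))
      \<le> (\<Sum>S\<in>nsets V m. D * (\<Lambda> + real (card {C \<in> nsets S (l + 1). clique E C})))"
    by (intro sum_mono local)
  also have "\<dots> = D * (A * \<Lambda> + q * L)"
    unfolding sum_distrib_left[symmetric] sum.distrib count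
    using V by (simp add: nsets_choose A_def n_def)
  finally have "wnorm (clique E) t k p V (\<lambda>_. 1) * R powr p \<le> B powr (p - 1) * (D * (A * \<Lambda> + q * L))"
    by (simp add: mult_left_mono)
  then have "wnorm (clique E) t k p V (\<lambda>_. 1) \<le> B powr (p - 1) * (D * (A * \<Lambda> + q * L)) / R powr p"
    using pos by (simp add: pos_le_divide_eq)
  \<comment> \<open>The powers regroup as B powr (p - 1) / R powr p = (B / R) powr p / B. Three
    ratios of binomial coefficients remain, each evaluated by \<open>choose_mult\<close>.\<close>
  also have "\<dots> = A / B * (B / R) powr p * (D * (\<Lambda> + q * (L / A)))"
    using pos by (simp add: powr_divide powr_diff field_simps)
  also have "A / B = real (n choose t) / real (m choose t)"
  proof -
    have "A * real (m choose t) = real (n choose t) * B"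
      using choose_mult[of t m n] m by (simp add: A_def B_def n_def flip: of_nat_mult)
    then show ?thesis using pos m by (simp add: frac_eq_eq)
  qed
  also have "B / R = real ((n - t) choose k) / real ((m - t) choose k)"
  proof -
    have "B * real ((m - t) choose k) = real ((n - t) choose k) * R"
      using choose_mult[of k "m - t" "n - t"] m by (simp add: R_def B_def n_def flip: of_nat_mult)
    then show ?thesis using pos m by (simp add: frac_eq_eq)
  qed
  also have "L / A = real (m choose (l + 1)) / real (n choose (l + 1))"
  proof -
    have "A * real (m choose (l + 1)) = real (n choose (l + 1)) * L"
      using choose_mult[of "l + 1" m n] m by (simp add: A_def L_def n_def flip: of_nat_mult)
    moreover have "real (n choose (l + 1)) > 0" using m by (simp add: n_def)
    ultimately show ?thesis using pos by (simp add: frac_eq_eq mult.commute)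
  qed
  finally show ?thesis unfolding D_def q_def n_def .
qed

section \<open>From ratios of binomial coefficients to powers\<close>

text \<open>The right side is a falling factorial of k factors, none below n - k; for n < k
  truncated subtraction makes the left side 0.\<close>

lemma power_le_fact_times_choose: "(n - k) ^ k \<le> fact k * (n choose k)"
proof (induction k arbitrary: n)
  case (Suc k)
  have "(n - Suc k) ^ Suc k \<le> n * (n - 1 - k) ^ k"
    unfolding power_Suc by (rule mult_mono) simp_all
  also have "\<dots> \<le> n * (fact k * ((n - 1) choose k))"
    by (intro mult_left_mono Suc.IH) simp
  also have "\<dots> = fact k * (Suc k * (n choose Suc k))"
    unfolding binomial_absorption by (rule mult.left_commute)
  also have "\<dots> = fact (Suc k) * (n choose Suc k)"
    by (simp only: fact_Suc of_nat_id mult_ac)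
  finally show ?case .
qed simp

text \<open>With powers in place of binomial coefficients, the dependence on n separates from that
  on m. The number s stands for the vertices of T already removed from the sample.\<close>

lemma choose_ratio_le:
  assumes "s + k < m" "n' \<le> n"
  shows "real (n' choose k) / real ((m - s) choose k) \<le> real n ^ k / real (m - s - k) ^ k"
proof -
  have pos: "real (m - s - k) ^ k > 0" "real ((m - s) choose k) > 0" using assms by auto
  have "real (n' choose k) * real (m - s - k) ^ k \<le> real (n' choose k) * (fact k * real ((m - s) choose k))"
  proof (rule mult_left_mono)
    have "real ((m - s - k) ^ k) \<le> real (fact k * ((m - s) choose k))"
      by (rule of_nat_mono[OF power_le_fact_times_choose])
    then show "real (m - s - k) ^ k \<le> fact k * real ((m - s) choose k)" by simp
  qed simp
  also have "\<dots> = real ((n' choose k) * fact k) * real ((m - s) choose k)" by simp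
  also have "\<dots> \<le> real (n' ^ k) * real ((m - s) choose k)"
    by (intro mult_right_mono of_nat_mono binomial_fact_pow) simp
  also have "\<dots> \<le> real n ^ k * real ((m - s) choose k)"
    using assms by (intro mult_right_mono) (simp_all add: power_mono)
  finally show ?thesis using pos by (simp add: divide_simps mult.commute)
qed

lemma tendsto_shifted_ratio: "(\<lambda>m. real m / real (m - c)) \<longlonglongrightarrow> 1"
proof (rule LIMSEQ_offset[where k = c])
  have "(\<lambda>m. 1 + real c / real m) \<longlonglongrightarrow> 1 + 0"
    by (intro tendsto_intros lim_const_over_n)
  moreover have "\<forall>\<^sub>F m in sequentially. 1 + real c / real m = real (m + c) / real (m + c - c)"
    using eventually_gt_at_top[of 0] by eventually_elim (simp add: field_simps)
  ultimately show "(\<lambda>m. real (m + c) / real (m + c - c)) \<longlonglongrightarrow> 1"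
    using Lim_transform_eventually by fastforce
qed

text \<open>The sample size m is fixed first and makes the binomial ratios cost at most \<epsilon> /
  2. The clique density \<delta> is chosen afterwards, so that it absorbs the factor (m choose (l +
  1)).\<close>

lemma wnorm_few_cliques_le:
  fixes \<Lambda> \<epsilon> p :: real
  assumes p: "p \<ge> 1" and \<epsilon>: "\<epsilon> > 0"
    and \<Lambda>: "\<And>y. y \<in> std_simplex {1..l} \<Longrightarrow> wnorm (\<lambda>_. True) t k p {1..l} y \<le> \<Lambda>" "\<Lambda> \<ge> 0"
  obtains m \<delta> where "\<delta> > 0"
    "\<And>(V :: 'a set) E. finite V \<Longrightarrow> m \<le> card V \<Longrightarrow> (\<And>a b. E a b \<Longrightarrow> E b a) \<Longrightarrow>
      real (card {S \<in> nsets V (l + 1). clique E S}) \<le> \<delta> * real (card V) ^ (l + 1) \<Longrightarrow>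
      wnorm (clique E) t k p V (\<lambda>_. 1) \<le> (\<Lambda> + \<epsilon>) * (real (card V) ^ t * (real (card V) ^ k) powr p)"
proof -
  \<comment> \<open>The loss from bounding (m choose t) and ((m - t) choose k) by powers of m - (t +
    k), measured against powers of m; it tends to 1.\<close>
  define \<rho> where "\<rho> m = (real m / real (m - (t + k))) ^ t * ((real m / real (m - (t + k))) ^ k) powr p" for m
  have "(\<lambda>m. \<rho> m * (\<Lambda> + \<epsilon> / 2)) \<longlonglongrightarrow> 1 ^ t * (1 ^ k) powr p * (\<Lambda> + \<epsilon> / 2)"
    unfolding \<rho>_def by (intro tendsto_intros tendsto_shifted_ratio) simp
  then have "\<forall>\<^sub>F m in sequentially. \<rho> m * (\<Lambda> + \<epsilon> / 2) < \<Lambda> + \<epsilon>"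
    using \<epsilon> by (intro order_tendstoD(2)) auto
  then obtain m0 where m0: "\<And>m. m \<ge> m0 \<Longrightarrow> \<rho> m * (\<Lambda> + \<epsilon> / 2) < \<Lambda> + \<epsilon>"
    by (auto simp: eventually_sequentially)
  define m where "m = Suc (m0 + t + k + l)"
  \<comment> \<open>One factor is the number of (l + 1)-subsets of a sample; the other comes from (n
    / (l + 1)) ^ (l + 1) <= (n choose (l + 1)).\<close>
  define M where "M = real (m choose (l + 1)) * real (l + 1) ^ (l + 1)"
  have mpos: "real (m choose (l + 1)) > 0"
    unfolding of_nat_0_less_iff by (rule zero_less_binomial) (simp add: m_def)
  then have M: "M > 0" by (simp add: M_def del: power_Suc)
  have \<rho>0: "\<rho> m \<ge> 0" by (simp add: \<rho>_def)
  show thesis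
  proof (rule that[of "\<epsilon> / 2 / M" m])
    show "\<epsilon> / 2 / M > 0" using \<epsilon> M by simp
    fix V :: "'a set" and E
    assume V: "finite V" "m \<le> card V" and sym: "\<And>a b. E a b \<Longrightarrow> E b a"
      and few: "real (card {S \<in> nsets V (l + 1). clique E S}) \<le> \<epsilon> / 2 / M * real (card V) ^ (l + 1)"
    let ?n = "card V"
    let ?q = "real (card {S \<in> nsets V (l + 1). clique E S})"
    have n: "l + 1 \<le> ?n" "?n > 0" using V(2) by (auto simp: m_def)
    have "?q * (real (m choose (l + 1)) / real (?n choose (l + 1))) \<le> \<epsilon> / 2"
    proof -
      have c: "(real ?n / real (l + 1)) ^ (l + 1) \<le> real (?n choose (l + 1))"
        using binomial_ge_n_over_k_pow_k[OF n(1), where 'a = real] by simp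
      have "?q * real (m choose (l + 1)) \<le> \<epsilon> / 2 / M * real ?n ^ (l + 1) * real (m choose (l + 1))"
        by (intro mult_right_mono few) simp
      also have "\<dots> = \<epsilon> / 2 * (real ?n / real (l + 1)) ^ (l + 1)"
        proof -
        have "\<epsilon> / 2 / (c * d) * N * c = \<epsilon> / 2 * (N / d)" if "c > 0" for c d N :: real
          using that by simp
        from this[OF mpos] show ?thesis unfolding M_def power_divide .
      qed
      also have "\<dots> \<le> \<epsilon> / 2 * real (?n choose (l + 1))"
        using c \<epsilon> by (intro mult_left_mono) auto
      finally show ?thesis using n by (simp add: pos_divide_le_eq)
    qed
    then have X: "\<Lambda> + ?q * (real (m choose (l + 1)) / real (?n choose (l + 1))) \<le> \<Lambda> + \<epsilon> / 2" by simp
    have "wnorm (clique E) t k p V (\<lambda>_. 1) \<le>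
      real (?n choose t) / real (m choose t) * (real ((?n - t) choose k) / real ((m - t) choose k)) powr p *
      (real m ^ t * (real m ^ k) powr p * (\<Lambda> + ?q * (real (m choose (l + 1)) / real (?n choose (l + 1)))))"
      using V by (intro wnorm_clique_sampling_le[OF _ p _ _ _ sym \<Lambda>]) (auto simp: m_def)
    also have "\<dots> \<le> real ?n ^ t / real (m - (t + k)) ^ t * (real ?n ^ k / real (m - (t + k)) ^ k) powr p *
      (real m ^ t * (real m ^ k) powr p * (\<Lambda> + \<epsilon> / 2))"
    proof (intro mult_mono powr_mono2 X)
      have "real (?n choose t) / real (m choose t) \<le> real ?n ^ t / real (m - t) ^ t"
        using choose_ratio_le[of 0 t m ?n ?n] by (simp add: m_def)
      also have "\<dots> \<le> real ?n ^ t / real (m - (t + k)) ^ t"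
        by (intro divide_left_mono power_mono mult_pos_pos) (auto simp: m_def)
      finally show "real (?n choose t) / real (m choose t) \<le> real ?n ^ t / real (m - (t + k)) ^ t" .
      show "real ((?n - t) choose k) / real ((m - t) choose k) \<le> real ?n ^ k / real (m - (t + k)) ^ k"
        using choose_ratio_le[of t k m "?n - t" ?n] by (simp add: m_def)
    qed (use p \<Lambda>(2) in auto)
    also have "\<dots> = \<rho> m * (\<Lambda> + \<epsilon> / 2) * (real ?n ^ t * (real ?n ^ k) powr p)"
      by (simp add: \<rho>_def power_divide powr_divide)
    also have "\<dots> \<le> (\<Lambda> + \<epsilon>) * (real ?n ^ t * (real ?n ^ k) powr p)"
      using m0[of m] by (intro mult_right_mono) (auto simp: m_def)
    finally show "wnorm (clique E) t k p V (\<lambda>_. 1) \<le> (\<Lambda> + \<epsilon>) * (real ?n ^ t * (real ?n ^ k) powr p)" .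
  qed
qed

section \<open>Embedding expansions\<close>

lemma listset_conv: "xs \<in> listset As \<longleftrightarrow> length xs = length As \<and> (\<forall>i<length As. xs ! i \<in> As ! i)"
proof (induction As arbitrary: xs)
  case (Cons A As)
  show ?case
    by (cases xs) (auto simp: set_Cons_def Cons.IH nth_Cons All_less_Suc2 split: nat.splits)
qed simp

text \<open>Erdos's theorem for ordered k-tuples, whose entries may repeat and whose parts may
  overlap, so that no partition of V has to be chosen. In the induction, many tuples xs have at
  least \<epsilon> n / 2 extensions y. By averaging, some s-set B consists of extensions of a
  positive proportion of them; the induction hypothesis applies to those tuples, and B becomes the
  new first part.\<close>

lemma dense_relation_contains_box:
  fixes \<epsilon> :: real
  assumes "\<epsilon> > 0" "s \<ge> 1"
  shows "\<exists>N. \<forall>(V :: 'a set) R. finite V \<longrightarrow> N \<le> card V \<longrightarrow>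
    R \<subseteq> {xs. set xs \<subseteq> V \<and> length xs = k} \<longrightarrow> \<epsilon> * real (card V) ^ k \<le> real (card R) \<longrightarrow>
    (\<exists>As. length As = k \<and> (\<forall>A\<in>set As. A \<in> nsets V s) \<and> listset As \<subseteq> R)"
  using assms(1)
proof (induction k arbitrary: \<epsilon>)
  case 0
  have "listset [] \<subseteq> R" if "R \<subseteq> {xs. set xs \<subseteq> V \<and> length xs = 0}" "\<epsilon> * real (card V) ^ 0 \<le> real (card R)"
    for V :: "'a set" and R
  proof -
    have "R \<noteq> {}" using that(2) 0 by auto
    then show ?thesis using that(1) by auto
  qed
  then show ?case by (intro exI[of _ 0]) auto
next
  case (Suc k)
  \<comment> \<open>At least \<epsilon> / 2 * n ^ k tuples have at least (\<epsilon> / 2 * n / s) ^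
    s sets B each, and there are at most n ^ s sets B in all.\<close>
  define \<epsilon>' where "\<epsilon>' = \<epsilon> / 2 * (\<epsilon> / 2 / real s) ^ s"
  have \<epsilon>': "\<epsilon>' > 0" using Suc.prems assms(2) by (simp add: \<epsilon>'_def)
  obtain N where N: "\<forall>(V :: 'a set) R. finite V \<longrightarrow> N \<le> card V \<longrightarrow>
    R \<subseteq> {xs. set xs \<subseteq> V \<and> length xs = k} \<longrightarrow> \<epsilon>' * real (card V) ^ k \<le> real (card R) \<longrightarrow>
    (\<exists>As. length As = k \<and> (\<forall>A\<in>set As. A \<in> nsets V s) \<and> listset As \<subseteq> R)"
    using Suc.IH[OF \<epsilon>'] by (elim exE)
  obtain N' where N': "real s / (\<epsilon> / 2) \<le> real N'" using real_arch_simple by blast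
  have "\<exists>As. length As = Suc k \<and> (\<forall>A\<in>set As. A \<in> nsets V s) \<and> listset As \<subseteq> R"
    if V: "finite V" "max N (Suc N') \<le> card V" and R: "R \<subseteq> {xs. set xs \<subseteq> V \<and> length xs = Suc k}"
      and big: "\<epsilon> * real (card V) ^ Suc k \<le> real (card R)" for V :: "'a set" and R
  proof -
    define n where "n = real (card V)"
    have n: "n > 0" using V by (simp add: n_def)
    have ns: "real s \<le> \<epsilon> / 2 * n"
    proof -
      have "real s / (\<epsilon> / 2) \<le> n" using N' V(2) by (simp add: n_def)
      then show ?thesis using Suc.prems by (simp add: pos_divide_le_eq mult.commute)
    qed
    define X where "X = {xs. set xs \<subseteq> V \<and> length xs = k}"
    have X: "finite X" "real (card X) = n ^ k"
      using V by (simp_all add: X_def finite_lists_length_eq card_lists_length_eq n_def)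
    define Nb where "Nb xs = {y \<in> V. y # xs \<in> R}" for xs
    have Nb: "finite (Nb xs)" "card (Nb xs) \<le> card V" for xs
      using V by (auto simp: Nb_def intro: card_mono)
    have "R = (\<lambda>(xs, y). y # xs) ` (SIGMA xs:X. Nb xs)"
    proof (intro equalityI subsetI)
      fix zs assume zs: "zs \<in> R"
      then obtain y xs where "zs = y # xs" using R by (cases zs) auto
      then show "zs \<in> (\<lambda>(xs, y). y # xs) ` (SIGMA xs:X. Nb xs)"
        using zs subsetD[OF R zs] by (intro image_eqI[of _ _ "(xs, y)"]) (auto simp: X_def Nb_def)
    qed (auto simp: Nb_def)
    moreover have "inj_on (\<lambda>(xs, y). y # xs) (SIGMA xs:X. Nb xs)" by (auto simp: inj_on_def)
    ultimately have "card R = (\<Sum>xs\<in>X. card (Nb xs))"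
      using X Nb by (simp add: card_image)
    then have cardR: "real (card R) = (\<Sum>xs\<in>X. real (card (Nb xs)))" by simp
    \<comment> \<open>Tuples outside \<open>Y\<close> have fewer than \<epsilon> / 2 * n extensions
      and account for at most half of the required \<epsilon> * n ^ Suc k.\<close>
    define Y where "Y = {xs \<in> X. \<epsilon> / 2 * n \<le> real (card (Nb xs))}"
    have Y: "finite Y" "Y \<subseteq> X" using X by (auto simp: Y_def)
    have "\<epsilon> * n ^ Suc k \<le> (\<Sum>xs\<in>X. real (card (Nb xs)))" using big cardR by (simp add: n_def)
    also have "\<dots> \<le> (\<Sum>xs\<in>X. \<epsilon> / 2 * n + (if xs \<in> Y then n else 0))"
    proof (rule sum_mono)
      fix xs assume "xs \<in> X"
      show "real (card (Nb xs)) \<le> \<epsilon> / 2 * n + (if xs \<in> Y then n else 0)"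
      proof (cases "xs \<in> Y")
        case True
        have "real (card (Nb xs)) \<le> n" "0 \<le> \<epsilon> / 2 * n" using Nb(2)[of xs] n Suc.prems by (auto simp: n_def)
        then show ?thesis using True by simp
      next
        case False
        then show ?thesis using \<open>xs \<in> X\<close> by (simp add: Y_def)
      qed
    qed
    also have "\<dots> = n ^ k * (\<epsilon> / 2 * n) + real (card Y) * n"
    proof -
      have "(\<Sum>xs\<in>X. if xs \<in> Y then n else 0) = (\<Sum>xs\<in>X \<inter> Y. n)"
        using X(1) by (rule sum.inter_restrict[symmetric])
      also have "X \<inter> Y = Y" using Y(2) by blast
      finally show ?thesis by (simp only: sum.distrib sum_constant X(2))
    qed
    finally have "\<epsilon> / 2 * n ^ k * n \<le> real (card Y) * n" by (simp add: algebra_simps)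
    then have cardY: "\<epsilon> / 2 * n ^ k \<le> real (card Y)" using n by (rule mult_right_le_imp_le)
    define R' where "R' B = {xs \<in> Y. B \<subseteq> Nb xs}" for B
    have swap: "(\<Sum>xs\<in>Y. card {B. B \<in> nsets V s \<and> B \<subseteq> Nb xs}) = (\<Sum>B\<in>nsets V s. card (R' B))"
      using sum.swap_restrict[of Y "nsets V s" "\<lambda>_ _. 1::nat" "\<lambda>xs B. B \<subseteq> Nb xs"] Y V
      by (simp add: finite_imp_finite_nsets R'_def)
    have low: "(\<epsilon> / 2 * n / real s) ^ s \<le> real (card {B. B \<in> nsets V s \<and> B \<subseteq> Nb xs})" if xs: "xs \<in> Y" for xs
    proof -
      have Nbxs: "\<epsilon> / 2 * n \<le> real (card (Nb xs))" using xs by (simp add: Y_def)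
      then have "s \<le> card (Nb xs)" using ns by linarith
      then have "(real (card (Nb xs)) / real s) ^ s \<le> real (card (Nb xs) choose s)"
        using binomial_ge_n_over_k_pow_k[where 'a = real] by blast
      moreover have "(\<epsilon> / 2 * n / real s) ^ s \<le> (real (card (Nb xs)) / real s) ^ s"
        using Nbxs n Suc.prems by (intro power_mono divide_right_mono) auto
      moreover have "{B. B \<in> nsets V s \<and> B \<subseteq> Nb xs} = nsets (Nb xs) s"
        by (auto simp: nsets_def Nb_def)
      ultimately show ?thesis using Nb by (simp add: nsets_choose)
    qed
    have "\<exists>B\<in>nsets V s. \<epsilon>' * n ^ k \<le> real (card (R' B))"
    proof (rule ccontr)
      assume "\<not> ?thesis"
      then have small: "real (card (R' B)) < \<epsilon>' * n ^ k" if "B \<in> nsets V s" for B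
        using that by (auto simp: not_le)
      \<comment> \<open>Some s-set must exist, or the strict comparison of sums below would be
        between empty sums.\<close>
      have "s \<le> card V"
      proof -
        have "0 < \<epsilon> / 2 * n ^ k" using n Suc.prems by simp
        then have "card Y > 0" using cardY by linarith
        then obtain xs where "xs \<in> Y" by (auto simp: card_gt_0_iff)
        then have "real s \<le> real (card (Nb xs))" using ns by (simp add: Y_def)
        then show ?thesis using Nb(2)[of xs] by simp
      qed
      then have ne: "nsets V s \<noteq> {}" using V by (simp add: nsets_eq_empty_iff)
      have fin: "finite (nsets V s)" using V by (simp add: finite_imp_finite_nsets)
      have "\<epsilon> / 2 * n ^ k * (\<epsilon> / 2 * n / real s) ^ s \<le> real (card Y) * (\<epsilon> / 2 * n / real s) ^ s"
        using cardY n Suc.prems by (intro mult_right_mono) auto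
      also have "\<dots> = (\<Sum>xs\<in>Y. (\<epsilon> / 2 * n / real s) ^ s)" by simp
      also have "\<dots> \<le> (\<Sum>xs\<in>Y. real (card {B. B \<in> nsets V s \<and> B \<subseteq> Nb xs}))" by (intro sum_mono low)
      also have "\<dots> = (\<Sum>B\<in>nsets V s. real (card (R' B)))"
        using swap by (simp flip: of_nat_sum)
      also have "\<dots> < (\<Sum>B\<in>nsets V s. \<epsilon>' * n ^ k)"
        using small ne fin by (intro sum_strict_mono) auto
      also have "\<dots> = real (card V choose s) * (\<epsilon>' * n ^ k)" using V by (simp add: nsets_choose)
      also have "\<dots> \<le> n ^ s * (\<epsilon>' * n ^ k)"
        using \<epsilon>' n choose_le_power[of "card V" s] by (intro mult_right_mono) (auto simp: n_def simp flip: of_nat_power)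
      also have "\<dots> = \<epsilon> / 2 * n ^ k * (\<epsilon> / 2 * n / real s) ^ s"
        by (simp add: \<epsilon>'_def power_divide power_mult_distrib)
      finally show False by simp
    qed
    then obtain B where B: "B \<in> nsets V s" "\<epsilon>' * n ^ k \<le> real (card (R' B))" by blast
    have "\<exists>As. length As = k \<and> (\<forall>A\<in>set As. A \<in> nsets V s) \<and> listset As \<subseteq> R' B"
      using B V by (intro N[rule_format]) (auto simp: R'_def Y_def X_def n_def)
    then obtain As where As: "length As = k" "\<forall>A\<in>set As. A \<in> nsets V s" "listset As \<subseteq> R' B" by blast
    have "listset (B # As) \<subseteq> R" using As(3) by (auto simp: set_Cons_def R'_def Nb_def)
    then show ?thesis using As B by (intro exI[of _ "B # As"]) auto
  qed
  then show ?case by blast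
qed

section \<open>Greedy choice of the added vertices\<close>

text \<open>The bound n ^ (r - card T) is written as a real quotient. For r = 2 and card T = 3
  truncated subtraction would yield 1 in place of 1 / n, too large for the comparison with rich
  pairs; the degree itself is then 0.\<close>

lemma deg_le_power:
  assumes H: "uniform r H" and T: "T \<subseteq> verts H" "verts H \<noteq> {}"
  shows "real (deg H T) \<le> real (card (verts H)) ^ r / real (card (verts H)) ^ card T"
proof -
  let ?n = "card (verts H)"
  have V: "finite (verts H)" using H by (simp add: uniform_def)
  have n: "real ?n > 0" using V T by (simp add: card_gt_0_iff)
  have sub: "{e \<in> edges H. T \<subseteq> e} \<subseteq> {e \<in> nsets (verts H) r. T \<subseteq> e}" using H by (auto simp: uniform_def)
  show ?thesis
  proof (cases "card T \<le> r")
    case True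
    have "deg H T \<le> card {e \<in> nsets (verts H) r. T \<subseteq> e}"
      unfolding deg_def using V sub by (intro card_mono) (simp_all add: finite_imp_finite_nsets)
    also have "\<dots> = (?n - card T) choose (r - card T)" using V T True by (intro card_nsets_supersets)
    also have "\<dots> \<le> (?n - card T) ^ (r - card T)" by (rule choose_le_power)
    also have "\<dots> \<le> ?n ^ (r - card T)" by (intro power_mono) simp_all
    finally have "real (deg H T) \<le> real (?n ^ (r - card T))" by (rule of_nat_mono)
    also have "\<dots> = real ?n ^ r / real ?n ^ card T"
      unfolding of_nat_power using n True by (simp add: power_diff)
    finally show ?thesis .
  next
    case False
    have "e \<notin> {e \<in> nsets (verts H) r. T \<subseteq> e}" for e
      using False by (auto simp: nsets_def dest: card_mono)
    then have "{e \<in> edges H. T \<subseteq> e} = {}" using sub by blast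
    then have "deg H T = 0" unfolding deg_def by (simp only: card.empty)
    then show ?thesis by simp
  qed
qed

text \<open>An edge over u and v that meets U elsewhere contains a third vertex w of U, and each w
  accounts for at most n ^ r / n ^ 3 edges.\<close>

lemma edge_avoiding_set:
  assumes H: "uniform r H" and uv: "u \<in> verts H" "v \<in> verts H" "u \<noteq> v"
    and U: "U \<subseteq> verts H" "card U \<le> M"
    and rich: "real M * (real (card (verts H)) ^ r / real (card (verts H)) ^ 3) < real (deg H {u, v})"
  obtains h where "h \<in> edges H" "{u, v} \<subseteq> h" "(h - {u, v}) \<inter> U = {}"
proof -
  let ?n = "real (card (verts H))"
  let ?D = "{e \<in> edges H. {u, v} \<subseteq> e}"
  have V: "finite (verts H)" using H by (simp add: uniform_def)
  have finU: "finite U" using U V finite_subset by blast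
  have finE: "finite (edges H)"
    using H V finite_imp_finite_nsets[OF V] by (auto simp: uniform_def intro: finite_subset)
  have "\<exists>h\<in>?D. (h - {u, v}) \<inter> U = {}"
  proof (rule ccontr)
    assume "\<not> ?thesis"
    then have "?D \<subseteq> (\<Union>w\<in>U - {u, v}. {e \<in> edges H. {u, v, w} \<subseteq> e})" by blast
    then have "card ?D \<le> card (\<Union>w\<in>U - {u, v}. {e \<in> edges H. {u, v, w} \<subseteq> e})"
      using finU finE by (intro card_mono) auto
    also have "\<dots> \<le> (\<Sum>w\<in>U - {u, v}. deg H {u, v, w})"
      unfolding deg_def using finU by (intro card_UN_le) simp
    finally have "real (deg H {u, v}) \<le> (\<Sum>w\<in>U - {u, v}. real (deg H {u, v, w}))"
      unfolding deg_def[of H "{u, v}"] by (simp flip: of_nat_sum)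
    also have "\<dots> \<le> (\<Sum>w\<in>U - {u, v}. ?n ^ r / ?n ^ 3)"
    proof (rule sum_mono)
      fix w assume w: "w \<in> U - {u, v}"
      then have "card {u, v, w} = 3" using uv by auto
      then show "real (deg H {u, v, w}) \<le> ?n ^ r / ?n ^ 3"
        using deg_le_power[OF H, of "{u, v, w}"] w uv U by auto
    qed
    also have "\<dots> \<le> real M * (?n ^ r / ?n ^ 3)"
    proof -
      have "card (U - {u, v}) \<le> M" using U(2) finU card_mono[of U "U - {u, v}"] by simp
      then show ?thesis unfolding sum_constant by (intro mult_right_mono) auto
    qed
    finally show False using rich by simp
  qed
  then show ?thesis using that by blast
qed

text \<open>\<open>P e\<close> is the pair to be extended, d the number of vertices it gains, and W
  is reserved from the start. M bounds W together with all vertices gained so far, so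
  \<open>avoid\<close> applies to each next edge.\<close>

lemma greedy_disjoint_edges:
  assumes fin: "finite Q" and W: "finite W" "W \<subseteq> V"
    and M: "card W + card Q * d \<le> M"
    and edges: "\<And>h. h \<in> Eds \<Longrightarrow> finite h \<and> h \<subseteq> V"
    and card: "\<And>e h. e \<in> Q \<Longrightarrow> h \<in> Eds \<Longrightarrow> P e \<subseteq> h \<Longrightarrow> card (h - P e) = d"
    and avoid: "\<And>e U. e \<in> Q \<Longrightarrow> U \<subseteq> V \<Longrightarrow> card U \<le> M \<Longrightarrow> \<exists>h\<in>Eds. P e \<subseteq> h \<and> (h - P e) \<inter> U = {}"
  shows "\<exists>h. (\<forall>e\<in>Q. h e \<in> Eds \<and> P e \<subseteq> h e \<and> (h e - P e) \<inter> W = {}) \<and>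
    (\<forall>e\<in>Q. \<forall>e'\<in>Q. e \<noteq> e' \<longrightarrow> (h e - P e) \<inter> (h e' - P e') = {})"
  using fin M card avoid
proof (induction Q rule: finite_induct)
  case (insert e Q)
  have "\<exists>h. (\<forall>e\<in>Q. h e \<in> Eds \<and> P e \<subseteq> h e \<and> (h e - P e) \<inter> W = {}) \<and>
    (\<forall>e\<in>Q. \<forall>e'\<in>Q. e \<noteq> e' \<longrightarrow> (h e - P e) \<inter> (h e' - P e') = {})"
  proof (rule insert.IH)
    show "card W + card Q * d \<le> M" using insert.prems(1) insert.hyps by simp
  qed (use insert.prems(2,3) in auto)
  then obtain h where hh: "(\<forall>e\<in>Q. h e \<in> Eds \<and> P e \<subseteq> h e \<and> (h e - P e) \<inter> W = {}) \<and>
    (\<forall>e\<in>Q. \<forall>e'\<in>Q. e \<noteq> e' \<longrightarrow> (h e - P e) \<inter> (h e' - P e') = {})" by (elim exE)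
  note h = hh[THEN conjunct1] hh[THEN conjunct2]
  define U where "U = W \<union> (\<Union>e\<in>Q. h e - P e)"
  have "card U \<le> card W + card (\<Union>e\<in>Q. h e - P e)" unfolding U_def by (rule card_Un_le)
  also have "card (\<Union>e\<in>Q. h e - P e) \<le> (\<Sum>e\<in>Q. card (h e - P e))"
    using insert.hyps(1) by (rule card_UN_le)
  also have "\<dots> = (\<Sum>e\<in>Q. d)" using h(1) insert.prems(2) by (intro sum.cong refl) blast
  finally have "card U \<le> M" using insert.prems(1) insert.hyps by simp
  moreover have "U \<subseteq> V" using W h(1) edges unfolding U_def by blast
  ultimately obtain f where f: "f \<in> Eds" "P e \<subseteq> f" "(f - P e) \<inter> U = {}"
    using insert.prems(3)[of e U] by blast
  have new: "(f - P e) \<inter> W = {}" "\<And>e'. e' \<in> Q \<Longrightarrow> (f - P e) \<inter> (h e' - P e') = {}"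
    using f(3) by (auto simp: U_def)
  have old: "(h(e := f)) e' = h e'" if "e' \<in> Q" for e' using that insert.hyps(2) by auto
  show ?case
  proof (intro exI[of _ "h(e := f)"] conjI ballI impI)
    fix a assume a: "a \<in> insert e Q"
    show "(h(e := f)) a \<in> Eds" "P a \<subseteq> (h(e := f)) a" "((h(e := f)) a - P a) \<inter> W = {}"
      using a f(1,2) new(1) h(1) by (cases "a = e"; simp)+
    fix b assume b: "b \<in> insert e Q" "a \<noteq> b"
    consider "a = e" "b \<in> Q" | "b = e" "a \<in> Q" | "a \<in> Q" "b \<in> Q" using a b by blast
    then show "((h(e := f)) a - P a) \<inter> ((h(e := f)) b - P b) = {}"
    proof cases
      case 1
      then show ?thesis using new(2)[of b] old[of b] by simp
    next
      case 2
      then show ?thesis using new(2)[of a] old[of a] by (simp add: Int_commute)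
    next
      case 3
      then show ?thesis using h(2) b(2) old[of a] old[of b] by simp
    qed
  qed
qed simp

text \<open>The coefficient in \<open>rich\<close> is the number of vertices of the whole expansion,
  which bounds the set to be avoided at every stage of the greedy choice.\<close>

lemma contains_expansion:
  fixes H :: "'b hypergraph" and F :: "'a hypergraph"
  assumes H: "uniform r H" and F: "uniform 2 F"
    and g: "inj_on g (verts F)" "g ` verts F \<subseteq> verts H"
    and rich: "\<And>u v. {u, v} \<in> edges F \<Longrightarrow> u \<noteq> v \<Longrightarrow>
      real (card (verts F) + card (edges F) * (r - 2)) *
        (real (card (verts H)) ^ r / real (card (verts H)) ^ 3) < real (deg H {g u, g v})"
  shows "contains_copy (expansion r F) H"
proof -
  let ?M = "card (verts F) + card (edges F) * (r - 2)"
  have fin: "finite (verts F)" "finite (edges F)"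
    using F finite_imp_finite_nsets by (auto simp: uniform_def intro: finite_subset)
  have edgeF: "\<exists>u v. e = {u, v} \<and> u \<noteq> v \<and> u \<in> verts F \<and> v \<in> verts F" if "e \<in> edges F" for e
  proof -
    have "e \<in> nsets (verts F) 2" using F that by (auto simp: uniform_def)
    then show ?thesis by (auto simp: nsets_2_eq)
  qed
  have edgeH: "finite h \<and> h \<subseteq> verts H \<and> card h = r" if "h \<in> edges H" for h
    using H that by (auto simp: uniform_def nsets_def)
  have card_g: "card (g ` e) = 2 \<and> finite (g ` e)" if e: "e \<in> edges F" for e
  proof -
    obtain u v where "e = {u, v}" "u \<noteq> v" "u \<in> verts F" "v \<in> verts F" using edgeF[OF e] by blast
    moreover from this have "g u \<noteq> g v" using inj_onD[OF g(1), of u v] by blast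
    ultimately show ?thesis by simp
  qed
  have "\<exists>h. (\<forall>e\<in>edges F. h e \<in> edges H \<and> g ` e \<subseteq> h e \<and> (h e - g ` e) \<inter> g ` verts F = {}) \<and>
    (\<forall>e\<in>edges F. \<forall>e'\<in>edges F. e \<noteq> e' \<longrightarrow> (h e - g ` e) \<inter> (h e' - g ` e') = {})"
  proof (rule greedy_disjoint_edges[OF fin(2)])
    show "card (g ` verts F) + card (edges F) * (r - 2) \<le> ?M"
      using card_image_le[OF fin(1), of g] by simp
    show "card (h - g ` e) = r - 2" if "e \<in> edges F" "h \<in> edges H" "g ` e \<subseteq> h" for e h
      using card_g[OF that(1)] edgeH[OF that(2)] that(3) by (simp add: card_Diff_subset)
    show "\<exists>h\<in>edges H. g ` e \<subseteq> h \<and> (h - g ` e) \<inter> U = {}"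
      if e: "e \<in> edges F" and U: "U \<subseteq> verts H" "card U \<le> ?M" for e U
    proof -
      obtain u v where uv: "e = {u, v}" "u \<noteq> v" "u \<in> verts F" "v \<in> verts F" using edgeF[OF e] by blast
      have "g u \<in> verts H" "g v \<in> verts H" "g u \<noteq> g v" using uv g inj_onD[OF g(1), of u v] by auto
      then obtain h where "h \<in> edges H" "{g u, g v} \<subseteq> h" "(h - {g u, g v}) \<inter> U = {}"
        using edge_avoiding_set[OF H _ _ _ U rich] e uv(1,2) by metis
      then show ?thesis using uv(1) by (intro bexI[of _ h]) auto
    qed
  qed (use fin g edgeH in auto)
  then obtain h where hh: "(\<forall>e\<in>edges F. h e \<in> edges H \<and> g ` e \<subseteq> h e \<and> (h e - g ` e) \<inter> g ` verts F = {}) \<and>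
    (\<forall>e\<in>edges F. \<forall>e'\<in>edges F. e \<noteq> e' \<longrightarrow> (h e - g ` e) \<inter> (h e' - g ` e') = {})" by (elim exE)
  have h: "h e \<in> edges H" "g ` e \<subseteq> h e" "(h e - g ` e) \<inter> g ` verts F = {}" if "e \<in> edges F" for e
    using bspec[OF hh[THEN conjunct1] that] by simp_all
  note disj = hh[THEN conjunct2, rule_format]
  have "\<exists>\<beta>. bij_betw \<beta> {..<r - 2} (h e - g ` e)" if "e \<in> edges F" for e
  proof -
    have "card (h e - g ` e) = r - 2" "finite (h e - g ` e)"
      using card_g[OF that] edgeH[OF h(1)[OF that]] h(2)[OF that] by (simp_all add: card_Diff_subset)
    then show ?thesis by (intro finite_same_card_bij) auto
  qed
  then obtain \<beta> where \<beta>: "\<And>e. e \<in> edges F \<Longrightarrow> bij_betw (\<beta> e) {..<r - 2} (h e - g ` e)" by metis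
  have \<beta>_in: "\<beta> e i \<in> h e - g ` e" if "e \<in> edges F" "i < r - 2" for e i
    using \<beta>[OF that(1)] that(2) by (auto simp: bij_betw_def)
  define f where "f = case_sum g (\<lambda>(e, i). \<beta> e i)"
  have f: "f (Inl u) = g u" "f (Inr (e, i)) = \<beta> e i" for u e i by (simp_all add: f_def)
  have "inj_on f (verts (expansion r F))"
  proof (rule inj_onI)
    fix a b assume ab: "a \<in> verts (expansion r F)" "b \<in> verts (expansion r F)" "f a = f b"
    have mix: "f (Inl u) \<noteq> f (Inr (e, i))" if "u \<in> verts F" "e \<in> edges F" "i < r - 2" for u e i
    proof -
      have "g u \<in> g ` verts F" using that(1) by (rule imageI)
      then show ?thesis
        using disjoint_iff[THEN iffD1, OF h(3)[OF that(2)], rule_format, OF \<beta>_in[OF that(2,3)]] by (auto simp: f)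
    qed
    consider u v where "a = Inl u" "b = Inl v" "u \<in> verts F" "v \<in> verts F"
      | u e i where "a = Inl u" "b = Inr (e, i)" "u \<in> verts F" "e \<in> edges F" "i < r - 2"
      | u e i where "b = Inl u" "a = Inr (e, i)" "u \<in> verts F" "e \<in> edges F" "i < r - 2"
      | e i e' i' where "a = Inr (e, i)" "b = Inr (e', i')" "e \<in> edges F" "i < r - 2" "e' \<in> edges F" "i' < r - 2"
      using ab(1,2) unfolding expansion_def by auto
    then show "a = b"
    proof cases
      case 1
      then show ?thesis using ab(3) inj_onD[OF g(1)] by (auto simp: f)
    next
      case 2
      then show ?thesis using mix ab(3) by auto
    next
      case 3
      then show ?thesis using mix ab(3) by metis
    next
      case 4
      have eq: "\<beta> e i = \<beta> e' i'" using ab(3) 4 by (simp add: f)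
      then have "e = e'" using disj[OF 4(3,5)] \<beta>_in[OF 4(3,4)] \<beta>_in[OF 4(5,6)] by auto
      then show ?thesis using eq \<beta>[OF 4(3)] 4 by (auto simp: bij_betw_def inj_on_def)
    qed
  qed
  moreover have "f ` verts (expansion r F) \<subseteq> verts H"
  proof -
    have "\<beta> e i \<in> verts H" if "e \<in> edges F" "i < r - 2" for e i
      using \<beta>_in[OF that] edgeH[OF h(1)[OF that(1)]] by blast
    then show ?thesis using g(2) by (auto simp: expansion_def f)
  qed
  moreover have "f ` e' \<in> edges H" if "e' \<in> edges (expansion r F)" for e'
  proof -
    obtain e where e: "e \<in> edges F" "e' = Inl ` e \<union> Inr ` ({e} \<times> {..<r - 2})"
      using \<open>e' \<in> edges (expansion r F)\<close> by (auto simp: expansion_def)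
    have "f ` e' = g ` e \<union> \<beta> e ` {..<r - 2}" unfolding e(2) by (force simp: f image_iff)
    also have "\<dots> = h e" using \<beta>[OF e(1)] h(2)[OF e(1)] by (auto simp: bij_betw_def)
    finally show ?thesis using h(1)[OF e(1)] by simp
  qed
  ultimately show ?thesis unfolding contains_copy_def by blast
qed

text \<open>Each colour class is injected into its own part. The parts are not assumed disjoint, but
  points of different parts are related by E, and E is irreflexive, so a common point is
  impossible.\<close>

lemma embed_into_box:
  fixes F :: "'a hypergraph"
  assumes F: "finite (verts F)" and c: "c ` verts F \<subseteq> {..<length As}"
    "\<And>u v. u \<noteq> v \<Longrightarrow> {u, v} \<in> edges F \<Longrightarrow> c u \<noteq> c v"
    and As: "\<forall>A\<in>set As. A \<in> nsets V s" "s \<ge> 1" "card (verts F) \<le> s"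
    and box: "\<And>xs i j. xs \<in> listset As \<Longrightarrow> i < length As \<Longrightarrow> j < length As \<Longrightarrow> i \<noteq> j \<Longrightarrow> E (xs ! i) (xs ! j)"
    and irrefl: "\<And>a. \<not> E a a"
  obtains g where "inj_on g (verts F)" "g ` verts F \<subseteq> V"
    "\<And>u v. u \<noteq> v \<Longrightarrow> u \<in> verts F \<Longrightarrow> v \<in> verts F \<Longrightarrow> {u, v} \<in> edges F \<Longrightarrow> E (g u) (g v)"
proof -
  have Ai: "As ! i \<subseteq> V \<and> finite (As ! i) \<and> card (As ! i) = s" if "i < length As" for i
    using As(1) nth_mem[OF that] by (auto simp: nsets_def)
  have cross: "E a b" if ij: "i < length As" "j < length As" "i \<noteq> j" "a \<in> As ! i" "b \<in> As ! j" for a b i j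
  proof -
    \<comment> \<open>A tuple through a and b; the other entries are arbitrary and exist because the
      parts are nonempty.\<close>
    define xs where "xs = map (\<lambda>m. if m = i then a else if m = j then b else SOME y. y \<in> As ! m) [0..<length As]"
    have "xs \<in> listset As"
      unfolding listset_conv
    proof (intro conjI allI impI)
      fix m assume m: "m < length As"
      have "As ! m \<noteq> {}" using Ai[OF m] As(2) by auto
      then have "(SOME y. y \<in> As ! m) \<in> As ! m" by (simp add: some_in_eq)
      then show "xs ! m \<in> As ! m" using m ij by (simp add: xs_def)
    qed (simp add: xs_def)
    then have "E (xs ! i) (xs ! j)" using ij by (intro box)
    then show ?thesis using ij by (simp add: xs_def)
  qed
  let ?X = "\<lambda>i. {u \<in> verts F. c u = i}"
  have "\<exists>f. inj_on f (?X i) \<and> f ` ?X i \<subseteq> As ! i" if i: "i < length As" for i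
  proof -
    have "card {u \<in> verts F. c u = i} \<le> card (verts F)" using F by (intro card_mono) auto
    also have "\<dots> \<le> card (As ! i)" using As(3) Ai[OF i] by simp
    finally show ?thesis using card_le_inj[of "{u \<in> verts F. c u = i}" "As ! i"] F Ai[OF i] by auto
  qed
  then have "\<forall>i. \<exists>f. i < length As \<longrightarrow> inj_on f (?X i) \<and> f ` ?X i \<subseteq> As ! i" by blast
  from choice[OF this] obtain f where f': "\<forall>i. i < length As \<longrightarrow> inj_on (f i) (?X i) \<and> f i ` ?X i \<subseteq> As ! i"
    by (elim exE)
  then have f: "inj_on (f i) (?X i)" "f i ` ?X i \<subseteq> As ! i" if "i < length As" for i
    using that by simp_all
  define g where "g u = f (c u) u" for u
  have cl: "c u < length As" if "u \<in> verts F" for u using c(1) that by auto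
  have g_in: "g u \<in> As ! c u" if "u \<in> verts F" for u
    using f(2)[OF cl[OF that]] that by (auto simp: g_def)
  show thesis
  proof (rule that)
    show "inj_on g (verts F)"
    proof (rule inj_onI)
      fix u v assume uv: "u \<in> verts F" "v \<in> verts F" "g u = g v"
      have "c u = c v"
        using cross[OF cl[OF uv(1)] cl[OF uv(2)] _ g_in[OF uv(1)] g_in[OF uv(2)]] irrefl uv(3) by auto
      then show "u = v" using inj_onD[OF f(1)[OF cl[OF uv(1)]], of u v] uv by (simp add: g_def)
    qed
    show "g ` verts F \<subseteq> V" using g_in Ai cl by blast
    show "E (g u) (g v)" if "u \<noteq> v" "u \<in> verts F" "v \<in> verts F" "{u, v} \<in> edges F" for u v
      using cross[OF cl[OF that(2)] cl[OF that(3)] c(2)[OF that(1,4)] g_in[OF that(2)] g_in[OF that(3)]] .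
  qed
qed

lemma few_rich_cliques:
  fixes F :: "'a hypergraph" and \<delta> \<epsilon> :: real
  assumes F: "uniform 2 F" "colourable q F" and pos: "\<delta> > 0" "\<epsilon> > 0"
  shows "\<exists>N. \<forall>H :: 'b hypergraph. uniform r H \<longrightarrow> \<not> contains_copy (expansion r F) H \<longrightarrow> N \<le> card (verts H) \<longrightarrow>
    real (card {S \<in> nsets (verts H) q.
      clique (\<lambda>u v. u \<noteq> v \<and> \<delta> * (real (card (verts H)) ^ r / real (card (verts H)) ^ 2) \<le> real (deg H {u, v})) S})
    \<le> \<epsilon> * real (card (verts H)) ^ q"
proof -
  define M where "M = card (verts F) + card (edges F) * (r - 2)"
  \<comment> \<open>The successor keeps the part size positive even if F has no vertices.\<close>
  define s where "s = Suc (card (verts F))"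
  obtain c where c': "c ` verts F \<subseteq> {..<q} \<and> (\<forall>u v. u \<noteq> v \<longrightarrow> {u, v} \<in> edges F \<longrightarrow> c u \<noteq> c v)"
    using F(2) unfolding colourable_def by (elim exE)
  note c = c'[THEN conjunct1] c'[THEN conjunct2, rule_format]
  have "s \<ge> 1" by (simp add: s_def)
  from dense_relation_contains_box[OF pos(2) this, where k = q]
  obtain N where N: "\<forall>(V :: 'b set) R. finite V \<longrightarrow> N \<le> card V \<longrightarrow>
    R \<subseteq> {xs. set xs \<subseteq> V \<and> length xs = q} \<longrightarrow> \<epsilon> * real (card V) ^ q \<le> real (card R) \<longrightarrow>
    (\<exists>As. length As = q \<and> (\<forall>A\<in>set As. A \<in> nsets V s) \<and> listset As \<subseteq> R)"
    by (elim exE)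
  \<comment> \<open>Once n > M / \<delta>, the M * n ^ r / n ^ 3 edges lost by avoiding M vertices
    are fewer than the \<delta> * n ^ r / n ^ 2 edges over a rich pair.\<close>
  obtain N' where N': "real M / \<delta> < real N'" using reals_Archimedean2 by blast
  have "real (card {S \<in> nsets (verts H) q. clique E S}) \<le> \<epsilon> * real (card (verts H)) ^ q"
    if H: "uniform r H" "\<not> contains_copy (expansion r F) H" "max N (Suc N') \<le> card (verts H)"
      and E_def: "E = (\<lambda>u v. u \<noteq> v \<and> \<delta> * (real (card (verts H)) ^ r / real (card (verts H)) ^ 2) \<le> real (deg H {u, v}))"
    for H :: "'b hypergraph" and E
  proof (rule ccontr)
    assume many: "\<not> ?thesis"
    define n where "n = real (card (verts H))"
    have V: "finite (verts H)" using H(1) by (simp add: uniform_def)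
    have n: "n > 0" "real M / \<delta> < n" using H(3) N' by (auto simp: n_def)
    \<comment> \<open>The ordered cliques. Each q-clique is the set of entries of at least one of
      them, so \<open>R\<close> is at least as large as the set of q-cliques.\<close>
    define R where "R = {xs. set xs \<subseteq> verts H \<and> length xs = q \<and> (\<forall>i<q. \<forall>j<q. i \<noteq> j \<longrightarrow> E (xs ! i) (xs ! j))}"
    have finR: "finite R"
      using finite_lists_length_eq[OF V, of q] by (rule rev_finite_subset) (auto simp: R_def)
    have sub: "{S \<in> nsets (verts H) q. clique E S} \<subseteq> set ` R"
    proof
      fix S assume S: "S \<in> {S \<in> nsets (verts H) q. clique E S}"
      then obtain xs where xs: "set xs = S" "distinct xs" using finite_distinct_list[of S] by (auto simp: nsets_def)
      then have len: "length xs = q" using S distinct_card[of xs] by (auto simp: nsets_def)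
      have "E (xs ! i) (xs ! j)" if "i < q" "j < q" "i \<noteq> j" for i j
        using S xs len that nth_mem[of i xs] nth_mem[of j xs] nth_eq_iff_index_eq[of xs i j]
        by (auto simp: clique_def)
      then have "xs \<in> R" using S xs len by (auto simp: R_def nsets_def)
      then show "S \<in> set ` R" using xs by blast
    qed
    have "card {S \<in> nsets (verts H) q. clique E S} \<le> card R"
      using card_mono[OF finite_imageI[OF finR] sub] card_image_le[OF finR] by (rule le_trans)
    then have "\<epsilon> * real (card (verts H)) ^ q \<le> real (card R)" using many by linarith
    moreover have "R \<subseteq> {xs. set xs \<subseteq> verts H \<and> length xs = q}" by (auto simp: R_def)
    moreover have "N \<le> card (verts H)" using H(3) by simp
    ultimately obtain As where As: "length As = q" "\<forall>A\<in>set As. A \<in> nsets (verts H) s" "listset As \<subseteq> R"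
      using N V by blast
    have box: "E (xs ! i) (xs ! j)" if "xs \<in> listset As" "i < length As" "j < length As" "i \<noteq> j" for xs i j
      using subsetD[OF As(3) that(1)] that As(1) by (auto simp: R_def)
    obtain g where g: "inj_on g (verts F)" "g ` verts F \<subseteq> verts H"
      "\<And>u v. u \<noteq> v \<Longrightarrow> u \<in> verts F \<Longrightarrow> v \<in> verts F \<Longrightarrow> {u, v} \<in> edges F \<Longrightarrow> E (g u) (g v)"
    proof (rule embed_into_box[where F = F and c = c and As = As and V = "verts H" and s = s and E = E])
      show "finite (verts F)" using F(1) by (simp add: uniform_def)
    qed (use c As(1,2) box in \<open>auto simp: s_def E_def\<close>)
    have "contains_copy (expansion r F) H"
    proof (rule contains_expansion[OF H(1) F(1) g(1,2)])
      fix u v assume uv: "{u, v} \<in> edges F" "u \<noteq> v"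
      then have "u \<in> verts F" "v \<in> verts F" using F(1) by (auto simp: uniform_def nsets_def)
      then have "\<delta> * (n ^ r / n ^ 2) \<le> real (deg H {g u, g v})" using g(3) uv by (simp add: E_def n_def)
      moreover have "real M * (n ^ r / n ^ 3) < \<delta> * (n ^ r / n ^ 2)"
      proof -
        have "real M / n < \<delta>" using n pos(1) by (simp add: divide_simps mult.commute)
        then have "real M / n * (n ^ r / n ^ 2) < \<delta> * (n ^ r / n ^ 2)"
          using n by (intro mult_strict_right_mono) auto
        then show ?thesis by (simp add: power3_eq_cube power2_eq_square)
      qed
      ultimately show "real (card (verts F) + card (edges F) * (r - 2)) *
        (real (card (verts H)) ^ r / real (card (verts H)) ^ 3) < real (deg H {g u, g v})"
        by (simp add: M_def n_def)
    qed
    then show False using H(2) by blast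
  qed
  then show ?thesis by blast
qed

section \<open>Deleting edges with a poor pair\<close>

lemma sum_deg:
  assumes H: "uniform r H"
  shows "(\<Sum>T\<in>nsets (verts H) t. deg H T) = (r choose t) * card (edges H)"
proof -
  have V: "finite (verts H)" using H by (simp add: uniform_def)
  have fin: "finite (nsets (verts H) t)" "finite (edges H)"
    using H finite_imp_finite_nsets[OF V] by (auto simp: uniform_def intro: finite_subset)
  have "(\<Sum>T\<in>nsets (verts H) t. deg H T) = (\<Sum>T\<in>nsets (verts H) t. \<Sum>e | e \<in> edges H \<and> T \<subseteq> e. 1)"
    by (simp add: deg_def)
  also have "\<dots> = (\<Sum>e\<in>edges H. \<Sum>T | T \<in> nsets (verts H) t \<and> T \<subseteq> e. 1)"
    by (rule sum.swap_restrict[OF fin])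
  also have "\<dots> = (\<Sum>e\<in>edges H. r choose t)"
  proof (rule sum.cong[OF refl])
    fix e assume "e \<in> edges H"
    then have e: "e \<subseteq> verts H" "finite e" "card e = r" using H by (auto simp: uniform_def nsets_def)
    then have "{T. T \<in> nsets (verts H) t \<and> T \<subseteq> e} = nsets e t" by (auto simp: nsets_def)
    then show "(\<Sum>T | T \<in> nsets (verts H) t \<and> T \<subseteq> e. 1) = r choose t"
      using e by (simp add: nsets_choose)
  qed
  finally show ?thesis by simp
qed

text \<open>An edge that is not a clique contains a poor pair; there are at most n ^ 2 ordered
  pairs, and a poor one lies in at most \<delta> * n ^ r / n ^ 2 edges.\<close>

lemma card_edges_poor_pair_le:
  fixes \<delta> :: real
  assumes H: "uniform r H" and \<delta>: "\<delta> \<ge> 0"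
  defines "n \<equiv> real (card (verts H))"
  defines "E \<equiv> \<lambda>u v. u \<noteq> v \<and> \<delta> * (n ^ r / n ^ 2) \<le> real (deg H {u, v})"
  shows "real (card {e \<in> edges H. \<not> clique E e}) \<le> \<delta> * n ^ r"
proof -
  have V: "finite (verts H)" using H by (simp add: uniform_def)
  have fin: "finite (edges H)"
    using H finite_imp_finite_nsets[OF V] by (auto simp: uniform_def intro: finite_subset)
  let ?V2 = "verts H \<times> verts H"
  let ?D = "\<lambda>(u, v). if u \<noteq> v \<and> \<not> E u v then {e \<in> edges H. {u, v} \<subseteq> e} else {}"
  have "{e \<in> edges H. \<not> clique E e} \<subseteq> (\<Union>z\<in>?V2. ?D z)"
  proof
    fix e assume e: "e \<in> {e \<in> edges H. \<not> clique E e}"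
    then obtain u v where uv: "u \<in> e" "v \<in> e" "u \<noteq> v" "\<not> E u v" unfolding clique_def by blast
    moreover have "e \<subseteq> verts H" using e H by (auto simp: uniform_def nsets_def)
    ultimately show "e \<in> (\<Union>z\<in>?V2. ?D z)" using e by (intro UN_I[of "(u, v)"]) auto
  qed
  then have "card {e \<in> edges H. \<not> clique E e} \<le> card (\<Union>z\<in>?V2. ?D z)"
    using V fin by (intro card_mono) (auto split: prod.splits)
  also have "\<dots> \<le> (\<Sum>z\<in>?V2. card (?D z))" using V by (intro card_UN_le) simp
  finally have "real (card {e \<in> edges H. \<not> clique E e}) \<le> (\<Sum>z\<in>?V2. real (card (?D z)))"
    by (simp flip: of_nat_sum)
  also have "\<dots> \<le> (\<Sum>z\<in>?V2. \<delta> * (n ^ r / n ^ 2))"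
  proof (rule sum_mono)
    fix z assume "z \<in> ?V2"
    obtain u v where z: "z = (u, v)" by (cases z)
    have "0 \<le> \<delta> * (n ^ r / n ^ 2)" using \<delta> by (simp add: n_def)
    then show "real (card (?D z)) \<le> \<delta> * (n ^ r / n ^ 2)" by (auto simp: z E_def deg_def)
  qed
  also have "\<dots> = \<delta> * (n ^ r / n ^ 2) * n ^ 2"
    by (simp add: card_cartesian_product n_def power2_eq_square)
  also have "\<dots> \<le> \<delta> * n ^ r" using \<delta> by (cases "n = 0") (simp_all add: n_def)
  finally show ?thesis .
qed

text \<open>The edges split into A, with all pairs rich, and B. After division by n ^ (r - t) the
  degrees lie in the unit interval, where \<open>powr_add_le_uniform\<close> makes the contribution
  of B linear in its degrees up to a small error. These degrees sum to (r choose t) times the number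
  of edges of B, which \<delta> makes small.\<close>

lemma tp_norm_le_wnorm_rich_cliques:
  fixes p \<epsilon> :: real
  assumes p: "p > 0" and \<epsilon>: "\<epsilon> > 0" and t: "t \<le> r"
  obtains \<delta> where "\<delta> > 0"
    "\<And>H :: 'a hypergraph. uniform r H \<Longrightarrow> verts H \<noteq> {} \<Longrightarrow> tp_norm t p H \<le>
      wnorm (clique (\<lambda>u v. u \<noteq> v \<and> \<delta> * (real (card (verts H)) ^ r / real (card (verts H)) ^ 2) \<le> real (deg H {u, v})))
        t (r - t) p (verts H) (\<lambda>_. 1)
      + \<epsilon> * (real (card (verts H)) ^ t * (real (card (verts H)) ^ (r - t)) powr p)"
proof -
  obtain C where C: "C \<ge> 0" "\<And>a b. 0 \<le> a \<Longrightarrow> 0 \<le> b \<Longrightarrow> a + b \<le> 1 \<Longrightarrow> (a + b) powr p \<le> a powr p + \<epsilon> / 2 + C * b"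
    using powr_add_le_uniform[OF p, of "\<epsilon> / 2"] \<epsilon> by auto
  \<comment> \<open>The summand 1 keeps \<open>D\<close> positive, so that \<delta> can be obtained
    by division.\<close>
  define D where "D = C * real (r choose t) + 1"
  have D: "D > 0" "C * real (r choose t) \<le> D"
    using mult_nonneg_nonneg[OF C(1), of "real (r choose t)"] unfolding D_def by linarith+
  define \<delta> where "\<delta> = \<epsilon> / 2 / D"
  have \<delta>: "\<delta> > 0" "\<delta> * D = \<epsilon> / 2" using \<epsilon> D by (auto simp: \<delta>_def)
  show thesis
  proof (rule that[OF \<delta>(1)])
    fix H :: "'a hypergraph"
    assume H: "uniform r H" "verts H \<noteq> {}"
    define n where "n = real (card (verts H))"
    define k where "k = r - t"
    define E where "E = (\<lambda>u v. u \<noteq> v \<and> \<delta> * (n ^ r / n ^ 2) \<le> real (deg H {u, v}))"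
    define Q where "Q = n ^ k"
    have V: "finite (verts H)" using H by (simp add: uniform_def)
    have n: "n > 0" using V H by (simp add: n_def card_gt_0_iff)
    have Q: "Q > 0" using n by (simp add: Q_def)
    have fin: "finite (edges H)"
      using H finite_imp_finite_nsets[OF V] by (auto simp: uniform_def intro: finite_subset)
    define A where "A = Hypergraph (verts H) {e \<in> edges H. clique E e}"
    define B where "B = Hypergraph (verts H) {e \<in> edges H. \<not> clique E e}"
    have AB: "uniform r A" "uniform r B" "verts A = verts H" "verts B = verts H"
      using H by (auto simp: A_def B_def uniform_def)
    have deg: "deg H T = deg A T + deg B T" for T
    proof -
      have "{e \<in> edges H. T \<subseteq> e} = {e \<in> edges A. T \<subseteq> e} \<union> {e \<in> edges B. T \<subseteq> e}"
        "{e \<in> edges A. T \<subseteq> e} \<inter> {e \<in> edges B. T \<subseteq> e} = {}"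
        by (auto simp: A_def B_def)
      moreover have "finite {e \<in> edges A. T \<subseteq> e}" "finite {e \<in> edges B. T \<subseteq> e}"
        using fin by (auto simp: A_def B_def)
      ultimately show ?thesis unfolding deg_def by (simp only: card_Un_disjoint)
    qed
    have degQ: "real (deg H T) \<le> Q" if T: "T \<in> nsets (verts H) t" for T
    proof -
      have T': "T \<subseteq> verts H" "card T = t" using T by (auto simp: nsets_def)
      have "real (deg H T) \<le> n ^ r / n ^ t"
        using deg_le_power[OF H(1) T'(1) H(2)] unfolding T'(2) n_def .
      then show ?thesis using n t by (simp add: Q_def k_def power_diff)
    qed
    have summand: "real (deg H T) powr p \<le> real (deg A T) powr p + \<epsilon> / 2 * Q powr p + Q powr p * (C / Q) * real (deg B T)"
      if T: "T \<in> nsets (verts H) t" for T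
    proof -
      have "(real (deg A T) / Q + real (deg B T) / Q) powr p
          \<le> (real (deg A T) / Q) powr p + \<epsilon> / 2 + C * (real (deg B T) / Q)"
        using degQ[OF T] Q deg[of T] by (intro C(2)) (simp_all flip: add_divide_distrib)
      also have "real (deg A T) / Q + real (deg B T) / Q = real (deg H T) / Q"
        by (simp add: deg add_divide_distrib)
      finally have "Q powr p * (real (deg H T) / Q) powr p
          \<le> Q powr p * ((real (deg A T) / Q) powr p + \<epsilon> / 2 + C * (real (deg B T) / Q))"
        by (rule mult_left_mono) simp
      then show ?thesis using Q by (simp add: powr_divide distrib_left mult.assoc mult.commute mult.left_commute)
    qed
    have "tp_norm t p H \<le> (\<Sum>T\<in>nsets (verts H) t.
        real (deg A T) powr p + \<epsilon> / 2 * Q powr p + Q powr p * (C / Q) * real (deg B T))"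
      unfolding tp_norm_def by (intro sum_mono summand)
    also have "\<dots> = tp_norm t p A + real (card (verts H) choose t) * (\<epsilon> / 2 * Q powr p)
        + Q powr p * (C / Q) * (\<Sum>T\<in>nsets (verts H) t. real (deg B T))"
      unfolding sum.distrib sum_distrib_left[symmetric] sum_constant
      using V by (simp add: tp_norm_def AB nsets_choose)
    also have "(\<Sum>T\<in>nsets (verts H) t. real (deg B T)) = real (r choose t) * real (card (edges B))"
      using sum_deg[OF AB(2), of t] by (simp add: AB flip: of_nat_sum)
    also have "tp_norm t p A + real (card (verts H) choose t) * (\<epsilon> / 2 * Q powr p)
        + Q powr p * (C / Q) * (real (r choose t) * real (card (edges B)))
      \<le> wnorm (clique E) t k p (verts H) (\<lambda>_. 1) + n ^ t * (\<epsilon> / 2 * Q powr p)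
        + Q powr p * (C / Q) * (real (r choose t) * (\<delta> * n ^ r))"
    proof (intro add_mono mult_left_mono mult_right_mono)
      have "tp_norm t p A = wnorm (\<lambda>e. e \<in> edges A) t k p (verts H) (\<lambda>_. 1)"
        using tp_norm_eq_wnorm[OF AB(1) t] by (simp add: AB k_def)
      also have "\<dots> \<le> wnorm (clique E) t k p (verts H) (\<lambda>_. 1)"
        unfolding wnorm_one codeg_def using p V
        by (intro sum_mono powr_mono2 of_nat_mono card_mono)
          (auto simp: A_def finite_imp_finite_nsets)
      finally show "tp_norm t p A \<le> wnorm (clique E) t k p (verts H) (\<lambda>_. 1)" .
      have "real (card (verts H) choose t) \<le> real (card (verts H) ^ t)"
        by (rule of_nat_mono[OF choose_le_power])
      then show "real (card (verts H) choose t) \<le> n ^ t" by (simp add: n_def)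
      show "real (card (edges B)) \<le> \<delta> * n ^ r"
        using card_edges_poor_pair_le[OF H(1), of \<delta>] \<delta>(1) by (simp add: B_def E_def n_def)
    qed (use C(1) Q \<epsilon> in auto)
    also have "Q powr p * (C / Q) * (real (r choose t) * (\<delta> * n ^ r)) = (C * real (r choose t)) * \<delta> * (n ^ t * Q powr p)"
    proof -
      have "n ^ r = n ^ t * Q" using t by (simp add: Q_def k_def flip: power_add)
      then show ?thesis using Q by simp
    qed
    also have "\<dots> \<le> D * \<delta> * (n ^ t * Q powr p)"
      using D(2) \<delta>(1) n by (intro mult_right_mono) auto
    also have "D * \<delta> = \<epsilon> / 2" using \<delta>(2) by (simp add: mult.commute)
    finally have "tp_norm t p H \<le> wnorm (clique E) t k p (verts H) (\<lambda>_. 1) + \<epsilon> * (n ^ t * Q powr p)"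
      by (simp add: mult.left_commute)
    then show "tp_norm t p H \<le>
      wnorm (clique (\<lambda>u v. u \<noteq> v \<and> \<delta> * (real (card (verts H)) ^ r / real (card (verts H)) ^ 2) \<le> real (deg H {u, v})))
        t (r - t) p (verts H) (\<lambda>_. 1)
      + \<epsilon> * (real (card (verts H)) ^ t * (real (card (verts H)) ^ (r - t)) powr p)"
      unfolding E_def Q_def k_def n_def .
  qed
qed

section \<open>Blow-ups\<close>

text \<open>Part i of the blow-up consists of the pairs (i, j) with j < N i. Encoded as the graph of
  a choice function, a transversal has A as its first projection, so different index sets give
  disjoint families.\<close>

definition transversals :: "('i \<Rightarrow> nat) \<Rightarrow> 'i set \<Rightarrow> ('i \<times> nat) set set" where
  "transversals N A = (\<lambda>f. (\<lambda>i. (i, f i)) ` A) ` (PiE A (\<lambda>i. {..<N i}))"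

lemma card_transversals: 
  assumes "finite A"
  shows "card (transversals N A) = (\<Prod>i\<in>A. N i)"
proof -
  have "inj_on (\<lambda>f. (\<lambda>i. (i, f i)) ` A) (PiE A (\<lambda>i. {..<N i}))"
  proof (rule inj_onI)
    fix f g assume fg: "f \<in> PiE A (\<lambda>i. {..<N i})" "g \<in> PiE A (\<lambda>i. {..<N i})"
      "(\<lambda>i. (i, f i)) ` A = (\<lambda>i. (i, g i)) ` A"
    show "f = g"
    proof (rule PiE_ext[OF fg(1,2)])
      fix i assume "i \<in> A"
      then have "(i, f i) \<in> (\<lambda>i. (i, g i)) ` A" using fg(3) by blast
      then show "f i = g i" by auto
    qed
  qed
  then show ?thesis using assms by (simp add: transversals_def card_image card_PiE)
qed

lemma finite_transversals: "finite A \<Longrightarrow> finite (transversals N A)"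
  by (simp add: transversals_def finite_PiE)

lemma transversalsD:
  assumes "T \<in> transversals N A"
  shows "fst ` T = A" "inj_on fst T" "T \<subseteq> Sigma A (\<lambda>i. {..<N i})" "finite A \<Longrightarrow> finite T" "card T = card A"
proof -
  obtain f where f: "T = (\<lambda>i. (i, f i)) ` A" "f \<in> PiE A (\<lambda>i. {..<N i})"
    using assms by (auto simp: transversals_def)
  show fst: "fst ` T = A" and inj: "inj_on fst T" and "finite A \<Longrightarrow> finite T"
    using f by (auto simp: image_image inj_on_def)
  show "T \<subseteq> Sigma A (\<lambda>i. {..<N i})" using f by (auto simp: PiE_def Pi_def)
  show "card T = card A" using card_image[OF inj] fst by simp
qed

lemma sum_transversals:
  fixes g :: "('i \<times> nat) set \<Rightarrow> real"
  assumes "finite \<A>" "\<And>A. A \<in> \<A> \<Longrightarrow> finite A"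
  shows "(\<Sum>T\<in>(\<Union>A\<in>\<A>. transversals N A). g T) = (\<Sum>A\<in>\<A>. \<Sum>T\<in>transversals N A. g T)"
proof (rule sum.UNION_disjoint[OF assms(1)])
  show "\<forall>A\<in>\<A>. \<forall>B\<in>\<A>. A \<noteq> B \<longrightarrow> transversals N A \<inter> transversals N B = {}"
  proof (intro ballI impI equals0I)
    fix A B T assume "A \<noteq> B" "T \<in> transversals N A \<inter> transversals N B"
    then show False using transversalsD(1)[of T N A] transversalsD(1)[of T N B] by simp
  qed
qed (use assms in \<open>simp add: finite_transversals\<close>)

lemma expansion_uniform:
  assumes F: "uniform 2 F" and r: "r \<ge> 2"
  shows "uniform r (expansion r F)"
  unfolding uniform_def
proof (intro conjI subsetI)
  have fin: "finite (verts F)" "finite (edges F)"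
    using F finite_imp_finite_nsets by (auto simp: uniform_def intro: finite_subset)
  then show "finite (verts (expansion r F))" by (simp add: expansion_def)
  fix e' assume "e' \<in> edges (expansion r F)"
  then obtain e where e: "e \<in> edges F" "e' = Inl ` e \<union> Inr ` ({e} \<times> {..<r - 2})"
    by (auto simp: expansion_def)
  have e2: "e \<subseteq> verts F" "finite e" "card e = 2" using F e(1) by (auto simp: uniform_def nsets_def)
  have "card e' = card (Inl ` e :: ('a + 'a set \<times> nat) set) + card (Inr ` ({e} \<times> {..<r - 2}) :: ('a + 'a set \<times> nat) set)"
    unfolding e(2) using e2(2) by (intro card_Un_disjoint) auto
  also have "\<dots> = r" using e2 r by (simp add: card_image card_cartesian_product)
  finally show "e' \<in> nsets (verts (expansion r F)) r"
    using e e2 by (auto simp: nsets_def expansion_def)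
qed

text \<open>In the blow-up, the monomial of A counts the transversals of A, and the link sum at A
  bounds the degree of each of them from below. In a copy of the expansion, the part numbers of the
  vertices of F form a proper colouring.\<close>

lemma wnorm_le_ex_tp:
  fixes F :: "'a hypergraph" and N :: "nat \<Rightarrow> nat"
  assumes F: "uniform 2 F" "\<not> colourable l F" and r: "r \<ge> 2" "t \<le> r" and p: "p > 0" and l: "l \<ge> 1"
    and N: "(\<Sum>i\<in>{1..l}. N i) \<le> n"
  shows "wnorm (\<lambda>_. True) t (r - t) p {1..l} (\<lambda>i. real (N i)) \<le> ex_tp r t p n (expansion r F)"
proof -
  define k where "k = r - t"
  \<comment> \<open>Part 0 consists of isolated vertices that fill up the total to n.\<close>
  define V :: "(nat \<times> nat) set" where "V = {0} \<times> {..<n - (\<Sum>i\<in>{1..l}. N i)} \<union> Sigma {1..l} (\<lambda>i. {..<N i})"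
  define Eds where "Eds = {e \<in> nsets V r. inj_on fst e \<and> fst ` e \<subseteq> {1..l}}"
  define H where "H = Hypergraph V Eds"
  have V: "finite V" by (simp add: V_def)
  have "card V = (n - (\<Sum>i\<in>{1..l}. N i)) + (\<Sum>i\<in>{1..l}. N i)"
    unfolding V_def by (subst card_Un_disjoint) (auto simp: card_cartesian_product)
  then have cardV: "card V = n" using N by simp
  have H: "uniform r H" using V by (auto simp: H_def Eds_def uniform_def)
  have free: "\<not> contains_copy (expansion r F) H"
  proof
    assume "contains_copy (expansion r F) H"
    then obtain f where f: "inj_on f (verts (expansion r F))" "f ` verts (expansion r F) \<subseteq> V"
      "\<And>e. e \<in> edges (expansion r F) \<Longrightarrow> f ` e \<in> Eds"
      unfolding contains_copy_def H_def by auto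
    \<comment> \<open>Parts are numbered from 1, colours from 0. Part 0 shares colour 0 with part 1
      by truncated subtraction, but only isolated vertices of F can be mapped there.\<close>
    define c where "c u = fst (f (Inl u)) - 1" for u
    have "colourable l F"
      unfolding colourable_def
    proof (intro exI[of _ c] conjI allI impI)
      show "c ` verts F \<subseteq> {..<l}"
      proof (rule image_subsetI)
        fix u assume "u \<in> verts F"
        then have "f (Inl u) \<in> V" using f(2) by (auto simp: expansion_def)
        then have "fst (f (Inl u)) \<le> l" by (auto simp: V_def)
        then show "c u \<in> {..<l}" using l by (auto simp: c_def)
      qed
      fix u v assume uv: "u \<noteq> v" "{u, v} \<in> edges F"
      have uvF: "u \<in> verts F" "v \<in> verts F" using F(1) uv by (auto simp: uniform_def nsets_def)
      define e where "e = Inl ` {u, v} \<union> Inr ` ({{u, v}} \<times> {..<r - 2})"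
      have "e \<in> edges (expansion r F)" using uv(2) unfolding expansion_def e_def hypergraph.sel by (rule imageI)
      then have fe: "inj_on fst (f ` e)" "fst ` f ` e \<subseteq> {1..l}" using f(3)[of e] by (auto simp: Eds_def)
      have "f (Inl u) \<noteq> f (Inl v)" using inj_onD[OF f(1), of "Inl u" "Inl v"] uv(1) uvF by (auto simp: expansion_def)
      moreover have fuv: "f (Inl u) \<in> f ` e" "f (Inl v) \<in> f ` e" by (auto simp: e_def)
      ultimately have "fst (f (Inl u)) \<noteq> fst (f (Inl v))" using inj_onD[OF fe(1)] by blast
      moreover have "fst (f (Inl u)) \<ge> 1" "fst (f (Inl v)) \<ge> 1"
        using subsetD[OF fe(2) imageI[OF fuv(1)]] subsetD[OF fe(2) imageI[OF fuv(2)]] by auto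
      ultimately show "c u \<noteq> c v" by (simp add: c_def)
    qed
    then show False using F(2) by blast
  qed
  have trV: "transversals N A \<subseteq> nsets V j" if "A \<in> nsets {1..l} j" for A j
  proof
    fix T assume T: "T \<in> transversals N A"
    have A: "A \<subseteq> {1..l}" "finite A" "card A = j" using that by (auto simp: nsets_def)
    have "Sigma A (\<lambda>i. {..<N i}) \<subseteq> V" using A(1) by (auto simp: V_def)
    then show "T \<in> nsets V j" using transversalsD[OF T] A by (auto simp: nsets_def)
  qed
  \<comment> \<open>The transversals of the various I are different sets, and each of them extends T
    to an edge of the blow-up.\<close>
  have codeg: "(\<Sum>I\<in>nsets ({1..l} - A) k. \<Prod>i\<in>I. real (N i)) \<le> real (codeg (\<lambda>e. e \<in> edges H) k V T)"
    if A: "A \<in> nsets {1..l} t" and T: "T \<in> transversals N A" for A T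
  proof -
    have finI: "finite (nsets ({1..l} - A) k)" by (simp add: finite_imp_finite_nsets)
    have A': "A \<subseteq> {1..l}" "finite A" "card A = t" using A by (auto simp: nsets_def)
    have "(\<Sum>I\<in>nsets ({1..l} - A) k. \<Prod>i\<in>I. real (N i)) = (\<Sum>I\<in>nsets ({1..l} - A) k. \<Sum>J\<in>transversals N I. 1)"
      by (intro sum.cong refl) (auto simp: nsets_def card_transversals)
    also have "\<dots> = (\<Sum>J\<in>(\<Union>I\<in>nsets ({1..l} - A) k. transversals N I). 1)"
      by (rule sum_transversals[symmetric, OF finI]) (auto simp: nsets_def)
    also have "\<dots> = real (card (\<Union>I\<in>nsets ({1..l} - A) k. transversals N I))" by simp
    also have "\<dots> \<le> real (codeg (\<lambda>e. e \<in> edges H) k V T)"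
      unfolding codeg_def
    proof (intro of_nat_mono card_mono subsetI)
      fix J assume "J \<in> (\<Union>I\<in>nsets ({1..l} - A) k. transversals N I)"
      then obtain I where I: "I \<in> nsets ({1..l} - A) k" "J \<in> transversals N I" by blast
      have I': "I \<subseteq> {1..l} - A" "finite I" "card I = k" using I by (auto simp: nsets_def)
      note J = transversalsD[OF I(2)]
      note T' = transversalsD[OF T]
      have "T \<inter> J = {}" using J(1) T'(1) I'(1) by fastforce
      moreover have "J \<in> nsets V k" using trV[of I k] I I' by (auto simp: nsets_def)
      ultimately have 1: "J \<in> nsets (V - T) k" by (auto simp: nsets_def)
      have "inj_on fst (T \<union> J)"
        using J(1,2) T'(1,2) I'(1) by (auto simp: inj_on_Un)
      moreover have "fst ` (T \<union> J) \<subseteq> {1..l}" using J(1) T'(1) I'(1) A'(1) by (auto simp: image_Un)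
      moreover have "T \<union> J \<in> nsets V r"
        using subsetD[OF trV[OF A] T] 1 \<open>T \<inter> J = {}\<close> r(2) by (auto simp: nsets_def card_Un_disjoint k_def)
      ultimately show "J \<in> {I \<in> nsets (V - T) k. T \<union> I \<in> edges H}"
        using 1 by (simp add: H_def Eds_def)
    qed (use V in \<open>simp add: finite_imp_finite_nsets\<close>)
    finally show ?thesis .
  qed
  have "wnorm (\<lambda>_. True) t k p {1..l} (\<lambda>i. real (N i))
    = (\<Sum>A\<in>nsets {1..l} t. \<Sum>T\<in>transversals N A. (\<Sum>I\<in>nsets ({1..l} - A) k. \<Prod>i\<in>I. real (N i)) powr p)"
    unfolding wnorm_def by (intro sum.cong refl) (simp add: nsets_def card_transversals)
  also have "\<dots> \<le> (\<Sum>A\<in>nsets {1..l} t. \<Sum>T\<in>transversals N A. real (codeg (\<lambda>e. e \<in> edges H) k V T) powr p)"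
    using p by (intro sum_mono powr_mono2 codeg sum_nonneg prod_nonneg) auto
  also have "\<dots> = (\<Sum>T\<in>(\<Union>A\<in>nsets {1..l} t. transversals N A). real (codeg (\<lambda>e. e \<in> edges H) k V T) powr p)"
    by (rule sum_transversals[symmetric]) (auto simp: finite_imp_finite_nsets nsets_def)
  also have "\<dots> \<le> (\<Sum>T\<in>nsets V t. real (codeg (\<lambda>e. e \<in> edges H) k V T) powr p)"
    using trV V by (intro sum_mono2) (auto simp: finite_imp_finite_nsets)
  also have "\<dots> = tp_norm t p H"
    using tp_norm_eq_wnorm[OF H r(2)] by (simp add: wnorm_one k_def H_def)
  also have "\<dots> \<le> ex_tp r t p n (expansion r F)"
    using H cardV free expansion_uniform[OF F(1) r(1)] by (intro ex_tp_upper) (auto simp: H_def)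
  finally show ?thesis by (simp add: k_def)
qed

lemma tendsto_wnorm:
  assumes p: "p > 0" and x: "\<And>i. i \<in> V \<Longrightarrow> ((\<lambda>n. y n i) \<longlongrightarrow> x i) G" "\<And>n i. i \<in> V \<Longrightarrow> 0 \<le> y n i"
  shows "((\<lambda>n. wnorm C t k p V (y n)) \<longlongrightarrow> wnorm C t k p V x) G"
  unfolding wnorm_def
proof (intro tendsto_sum tendsto_mult tendsto_prod tendsto_powr' x(1) tendsto_const disjI2 conjI p always_eventually allI sum_nonneg prod_nonneg x(2))
qed (auto simp: nsets_def)

lemma tendsto_floor_ratio:
  fixes c :: real
  assumes "c \<ge> 0"
  shows "(\<lambda>n. real (nat \<lfloor>c * real n\<rfloor>) / real n) \<longlonglongrightarrow> c"
proof (rule tendsto_sandwich)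
  show "(\<lambda>n. c - 1 / real n) \<longlonglongrightarrow> c"
    using tendsto_diff[OF tendsto_const[of c] lim_const_over_n[of 1]] by simp
  show "\<forall>\<^sub>F n in sequentially. c - 1 / real n \<le> real (nat \<lfloor>c * real n\<rfloor>) / real n"
    using eventually_gt_at_top[of 0]
  proof eventually_elim
    case (elim n)
    have "c * real n - 1 \<le> real (nat \<lfloor>c * real n\<rfloor>)" by linarith
    then have "(c * real n - 1) / real n \<le> real (nat \<lfloor>c * real n\<rfloor>) / real n"
      by (rule divide_right_mono) simp
    then show ?case using elim by (simp add: diff_divide_distrib)
  qed
  show "\<forall>\<^sub>F n in sequentially. real (nat \<lfloor>c * real n\<rfloor>) / real n \<le> c"
    using eventually_gt_at_top[of 0]
  proof eventually_elim
    case (elim n)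
    have "0 \<le> c * real n" using assms by simp
    then have "real (nat \<lfloor>c * real n\<rfloor>) \<le> c * real n" by linarith
    then show ?case using elim by (simp add: field_simps)
  qed
qed simp

text \<open>Rounding x i * n down keeps the sum of the part sizes at most n and, by continuity of
  \<open>wnorm\<close>, changes the normalised norm arbitrarily little; homogeneity restores the
  power of n.\<close>

lemma ex_tp_eventually_ge:
  fixes F :: "'a hypergraph"
  assumes F: "uniform 2 F" "\<not> colourable l F" and r: "r \<ge> 2" "t \<le> r" and p: "p > 0" and l: "l \<ge> 1"
    and x: "x \<in> std_simplex {1..l}" and \<epsilon>: "\<epsilon> > 0"
  shows "\<forall>\<^sub>F n in sequentially. (wnorm (\<lambda>_. True) t (r - t) p {1..l} x - \<epsilon>) * (real n ^ t * (real n ^ (r - t)) powr p)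
    \<le> ex_tp r t p n (expansion r F)"
proof -
  let ?w = "wnorm (\<lambda>_. True) t (r - t) p {1..l}"
  define N where "N n i = nat \<lfloor>x i * real n\<rfloor>" for n i
  have x': "\<And>i. i \<in> {1..l} \<Longrightarrow> 0 \<le> x i" "(\<Sum>i\<in>{1..l}. x i) = 1" using x by (auto simp: std_simplex_def)
  have "(\<lambda>n. ?w (\<lambda>i. real (N n i) / real n)) \<longlonglongrightarrow> ?w x"
    unfolding N_def using p x'(1) by (intro tendsto_wnorm tendsto_floor_ratio) auto
  then have "\<forall>\<^sub>F n in sequentially. ?w x - \<epsilon> < ?w (\<lambda>i. real (N n i) / real n)"
    using \<epsilon> by (intro order_tendstoD(1)) auto
  then show ?thesis
    using eventually_gt_at_top[of 0]
  proof eventually_elim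
    case (elim n)
    have "(\<Sum>i\<in>{1..l}. N n i) \<le> n"
    proof -
      have "(\<Sum>i\<in>{1..l}. real (N n i)) \<le> (\<Sum>i\<in>{1..l}. x i * real n)"
      proof (rule sum_mono)
        fix i assume "i \<in> {1..l}"
        then have "0 \<le> x i * real n" using x'(1) by simp
        then show "real (N n i) \<le> x i * real n" unfolding N_def by linarith
      qed
      also have "\<dots> = real n" using x'(2) by (simp flip: sum_distrib_right)
      finally show ?thesis by (simp flip: of_nat_sum)
    qed
    note le = wnorm_le_ex_tp[OF F r p l this]
    have "(?w x - \<epsilon>) * (real n ^ t * (real n ^ (r - t)) powr p)
        \<le> ?w (\<lambda>i. real (N n i) / real n) * (real n ^ t * (real n ^ (r - t)) powr p)"
      using elim(1) by (intro mult_right_mono) auto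
    also have "\<dots> = ?w (\<lambda>i. real n * (real (N n i) / real n))"
      by (subst wnorm_scale) simp_all
    also have "(\<lambda>i. real n * (real (N n i) / real n)) = (\<lambda>i. real (N n i))" using elim(2) by auto
    finally show ?case using le by linarith
  qed
qed

section \<open>The density of expansions\<close>

lemma wnorm_nonneg: "(\<And>i. i \<in> V \<Longrightarrow> 0 \<le> x i) \<Longrightarrow> 0 \<le> wnorm C t k p V x"
  unfolding wnorm_def by (intro sum_nonneg mult_nonneg_nonneg prod_nonneg) (auto simp: nsets_def)

lemma sum_codeg_cliques:
  assumes V: "finite V"
  shows "(\<Sum>T\<in>nsets V t. codeg C k V T) = ((t + k) choose t) * card {S \<in> nsets V (t + k). C S}"
proof -
  define H where "H = Hypergraph V {S \<in> nsets V (t + k). C S}"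
  have H: "uniform (t + k) H" using V by (auto simp: H_def uniform_def)
  have "codeg C k V T = deg H T" if T: "T \<in> nsets V t" for T
  proof -
    have "T \<union> I \<in> nsets V (t + k)" if "I \<in> nsets (V - T) k" for I
    proof -
      have "T \<inter> I = {}" using that by (auto simp: nsets_def)
      then show ?thesis using T that by (auto simp: nsets_def card_Un_disjoint)
    qed
    then have "{I \<in> nsets (V - T) k. C (T \<union> I)} = {I \<in> nsets (V - T) k. T \<union> I \<in> edges H}"
      by (auto simp: H_def)
    then show ?thesis using deg_eq_codeg[OF H, of T t] T by (simp add: codeg_def H_def)
  qed
  then show ?thesis using sum_deg[OF H, of t] by (simp add: H_def)
qed

section \<open>The upper bound for p < 1\<close>

text \<open>The power mean inequality over the t-cliques bounds the norm by the number of t-cliques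
  to the power 1 - p times the sum of their codegrees to the power p. That sum is controlled by the
  number of (t + k)-cliques, and \<open>wnorm_few_cliques_le\<close> bounds both counts.\<close>

lemma wnorm_few_cliques_le_concave:
  fixes p \<epsilon> :: real
  assumes p: "0 < p" "p < 1" and \<epsilon>: "\<epsilon> > 0" and l: "l \<ge> 1" "t + k \<le> l"
  defines "\<Lambda> \<equiv> real (l choose t) * (1 / real l) ^ t * (real ((l - t) choose k) * (1 / real l) ^ k) powr p"
  obtains m \<delta> where "\<delta> > 0"
    "\<And>(V :: 'a set) E. finite V \<Longrightarrow> m \<le> card V \<Longrightarrow> (\<And>a b. E a b \<Longrightarrow> E b a) \<Longrightarrow>
      real (card {S \<in> nsets V (l + 1). clique E S}) \<le> \<delta> * real (card V) ^ (l + 1) \<Longrightarrow>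
      wnorm (clique E) t k p V (\<lambda>_. 1) \<le> (\<Lambda> + \<epsilon>) * (real (card V) ^ t * (real (card V) ^ k) powr p)"
proof -
  \<comment> \<open>\<open>a\<close> and \<open>b\<close> are the limiting densities of t-cliques
    and (t + k)-cliques, \<open>d\<close> is the link sum of a t-set at uniform weights, and
    \<open>G e\<close> is the bound obtained if both densities are exceeded by e.\<close>
  define a where "a = real (l choose t) * (1 / real l) ^ t"
  define b where "b = real (l choose (t + k)) * (1 / real l) ^ (t + k)"
  define c where "c = real ((t + k) choose t)"
  define d where "d = real ((l - t) choose k) * (1 / real l) ^ k"
  have ab: "a \<ge> 0" "b \<ge> 0" "c \<ge> 0" "a > 0" "d \<ge> 0" using l by (auto simp: a_def b_def c_def d_def)
  define G where "G e = (a + e) powr (1 - p) * (c * (b + e)) powr p" for e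
  \<comment> \<open>Both sides count t-sets inside (t + k)-sets of an l-set, divided by the same
    power of l. This identity makes the bound at e = 0 equal to \<Lambda>.\<close>
  have cb: "c * b = a * d"
  proof -
    have "(l choose (t + k)) * ((t + k) choose t) = (l choose t) * ((l - t) choose k)"
      using choose_mult[of t "t + k" l] l by simp
    then have "real (l choose (t + k)) * c = real (l choose t) * real ((l - t) choose k)"
      unfolding c_def by (simp only: flip: of_nat_mult)
    then show ?thesis unfolding a_def b_def d_def by (simp add: power_add mult_ac)
  qed
  have "G 0 = a powr (1 - p) * (a * d) powr p" by (simp add: G_def cb)
  also have "\<dots> = a powr (1 - p + p) * d powr p" unfolding powr_add powr_mult by simp
  also have "\<dots> = \<Lambda>" using ab by (simp add: \<Lambda>_def a_def d_def)
  finally have G0: "G 0 = \<Lambda>" .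
  have "(G \<longlongrightarrow> (a + 0) powr (1 - p) * (c * (b + 0)) powr p) (at_right 0)"
    unfolding G_def
  proof (intro tendsto_mult tendsto_powr' tendsto_add tendsto_const tendsto_ident_at disjI2 conjI)
    show "\<forall>\<^sub>F e in at_right 0. 0 \<le> a + e"
      using eventually_at_right_less[of "0::real"] by eventually_elim (use ab in simp)
    show "\<forall>\<^sub>F e in at_right 0. 0 \<le> c * (b + e)"
      using eventually_at_right_less[of "0::real"] by eventually_elim (use ab in simp)
  qed (use p in auto)
  then have "(G \<longlongrightarrow> \<Lambda>) (at_right 0)" using G0 by (simp add: G_def)
  then have "\<forall>\<^sub>F e in at_right 0. G e < \<Lambda> + \<epsilon>" using \<epsilon> by (intro order_tendstoD(2)) auto
  then have "\<forall>\<^sub>F e in at_right 0. G e < \<Lambda> + \<epsilon> \<and> 0 < e"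
    using eventually_at_right_less by (rule eventually_conj)
  then obtain e where e: "G e < \<Lambda> + \<epsilon>" "0 < e"
    using eventually_happens'[OF trivial_limit_at_right_real] by blast
  obtain m1 \<delta>1 where 1: "\<delta>1 > 0" "\<And>(V :: 'a set) E. finite V \<Longrightarrow> m1 \<le> card V \<Longrightarrow> (\<And>a b. E a b \<Longrightarrow> E b a) \<Longrightarrow>
      real (card {S \<in> nsets V (l + 1). clique E S}) \<le> \<delta>1 * real (card V) ^ (l + 1) \<Longrightarrow>
      wnorm (clique E) 0 t 1 V (\<lambda>_. 1) \<le> (a + e) * (real (card V) ^ 0 * (real (card V) ^ t) powr 1)"
    by (rule wnorm_few_cliques_le[OF order_refl e(2) _ ab(1), of l 0 t])
      (use wnorm_edges_simplex_le[OF l(1)] in \<open>auto simp: a_def\<close>)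
  obtain m2 \<delta>2 where 2: "\<delta>2 > 0" "\<And>(V :: 'a set) E. finite V \<Longrightarrow> m2 \<le> card V \<Longrightarrow> (\<And>a b. E a b \<Longrightarrow> E b a) \<Longrightarrow>
      real (card {S \<in> nsets V (l + 1). clique E S}) \<le> \<delta>2 * real (card V) ^ (l + 1) \<Longrightarrow>
      wnorm (clique E) 0 (t + k) 1 V (\<lambda>_. 1) \<le> (b + e) * (real (card V) ^ 0 * (real (card V) ^ (t + k)) powr 1)"
    by (rule wnorm_few_cliques_le[OF order_refl e(2) _ ab(2), of l 0 "t + k"])
      (use wnorm_edges_simplex_le[OF l(1)] in \<open>auto simp: b_def\<close>)
  show thesis
  proof (rule that[of "min \<delta>1 \<delta>2" "max 1 (max m1 m2)"])
    show "min \<delta>1 \<delta>2 > 0" using 1 2 by simp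
    fix V :: "'a set" and E
    assume V: "finite V" "max 1 (max m1 m2) \<le> card V" and sym: "\<And>a b. E a b \<Longrightarrow> E b a"
      and few: "real (card {S \<in> nsets V (l + 1). clique E S}) \<le> min \<delta>1 \<delta>2 * real (card V) ^ (l + 1)"
    define n where "n = real (card V)"
    have n: "n > 0" using V by (simp add: n_def)
    define q where "q j = real (card {S \<in> nsets V j. clique E S})" for j
    have few': "q (l + 1) \<le> \<delta>1 * n ^ (l + 1)" "q (l + 1) \<le> \<delta>2 * n ^ (l + 1)"
    proof -
      have "min \<delta>1 \<delta>2 * n ^ (l + 1) \<le> \<delta>1 * n ^ (l + 1)" "min \<delta>1 \<delta>2 * n ^ (l + 1) \<le> \<delta>2 * n ^ (l + 1)"
        using n by (intro mult_right_mono; simp)+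
      then show "q (l + 1) \<le> \<delta>1 * n ^ (l + 1)" "q (l + 1) \<le> \<delta>2 * n ^ (l + 1)"
        using few unfolding q_def n_def by linarith+
    qed
    have m12: "m1 \<le> card V" "m2 \<le> card V" using V(2) by simp_all
    have qt: "q t \<le> (a + e) * n ^ t"
      using 1(2)[OF V(1) m12(1) sym few'(1)[unfolded q_def n_def]] n
      by (simp add: wnorm_edge_count q_def n_def)
    have qr: "q (t + k) \<le> (b + e) * n ^ (t + k)"
      using 2(2)[OF V(1) m12(2) sym few'(2)[unfolded q_def n_def]] n
      by (simp add: wnorm_edge_count q_def n_def)
    \<comment> \<open>The power mean inequality brings in the number of terms. Only T that are
      cliques may be kept, so that this number is bounded through \<open>a\<close>.\<close>
    let ?X = "{T \<in> nsets V t. clique E T}"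
    have fin: "finite (nsets V t)" using V by (simp add: finite_imp_finite_nsets)
    have zero: "real (codeg (clique E) k V T) powr p = 0" if "T \<in> nsets V t - ?X" for T
    proof -
      have "\<not> clique E T" using that by blast
      then have "\<not> clique E (T \<union> I)" for I using clique_mono by blast
      then show ?thesis by (simp add: codeg_def)
    qed
    have "wnorm (clique E) t k p V (\<lambda>_. 1) = (\<Sum>T\<in>?X. real (codeg (clique E) k V T) powr p)"
      unfolding wnorm_one using fin zero by (intro sum.mono_neutral_right) auto
    also have "\<dots> \<le> q t powr (1 - p) * (\<Sum>T\<in>?X. real (codeg (clique E) k V T)) powr p"
      unfolding q_def using fin by (intro sum_powr_power_mean_concave p) auto
    also have "\<dots> \<le> q t powr (1 - p) * (c * q (t + k)) powr p"
    proof (intro mult_left_mono powr_mono2)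
      have "(\<Sum>T\<in>?X. real (codeg (clique E) k V T)) \<le> (\<Sum>T\<in>nsets V t. real (codeg (clique E) k V T))"
        using fin by (intro sum_mono2) auto
      also have "\<dots> = c * q (t + k)"
        using sum_codeg_cliques[OF V(1), of "clique E" k t] by (simp add: c_def q_def flip: of_nat_sum of_nat_mult)
      finally show "(\<Sum>T\<in>?X. real (codeg (clique E) k V T)) \<le> c * q (t + k)" .
    qed (use p in \<open>auto intro: sum_nonneg\<close>)
    also have "\<dots> \<le> ((a + e) * n ^ t) powr (1 - p) * (c * ((b + e) * n ^ (t + k))) powr p"
      using qt qr p ab by (intro mult_mono powr_mono2 mult_left_mono) (auto simp: q_def)
    also have "\<dots> = G e * ((n ^ t) powr (1 - p + p) * (n ^ k) powr p)"
      unfolding G_def power_add powr_mult powr_add by (simp only: mult_ac)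
    also have "(n ^ t) powr (1 - p + p) = n ^ t" using n by simp
    also have "G e * (n ^ t * (n ^ k) powr p) \<le> (\<Lambda> + \<epsilon>) * (n ^ t * (n ^ k) powr p)"
      using e(1) n by (intro mult_right_mono) auto
    finally show "wnorm (clique E) t k p V (\<lambda>_. 1) \<le> (\<Lambda> + \<epsilon>) * (real (card V) ^ t * (real (card V) ^ k) powr p)"
      unfolding n_def .
  qed
qed

section \<open>Matching the lower and upper bounds\<close>

lemma power_powr_combine:
  fixes x p :: real
  assumes "x > 0"
  shows "x ^ t * (x ^ k) powr p = x powr (real t + p * real k)"
  using assms by (simp add: powr_add powr_powr mult.commute flip: powr_realpow)

text \<open>The two ranges of p differ only in the weights \<open>x\<close> and in how they supply
  \<open>upper\<close>. Sets of naturals suffice there, because \<open>ex_tp\<close> is attained by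
  a hypergraph on {1..n}.\<close>

lemma tp_ratio_expansion_tendsto:
  fixes F :: "'a hypergraph" and \<Lambda> p :: real
  assumes F: "uniform 2 F" "\<not> colourable l F" "colourable (l + 1) F"
    and r: "r \<ge> 2" "t \<le> r" and p: "p > 0" and l: "l \<ge> 1"
    and x: "x \<in> std_simplex {1..l}" "wnorm (\<lambda>_. True) t (r - t) p {1..l} x = \<Lambda>"
    and upper: "\<And>\<epsilon>. \<epsilon> > 0 \<Longrightarrow> \<exists>m \<delta>. \<delta> > 0 \<and> (\<forall>(V :: nat set) E. finite V \<longrightarrow> m \<le> card V \<longrightarrow>
      (\<forall>a b. E a b \<longrightarrow> E b a) \<longrightarrow>
      real (card {S \<in> nsets V (l + 1). clique E S}) \<le> \<delta> * real (card V) ^ (l + 1) \<longrightarrow>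
      wnorm (clique E) t (r - t) p V (\<lambda>_. 1) \<le> (\<Lambda> + \<epsilon>) * (real (card V) ^ t * (real (card V) ^ (r - t)) powr p))"
  shows "tp_ratio r t p (expansion r F) \<longlonglongrightarrow> fact t * \<Lambda>"
proof -
  define N where "N n = real n ^ t * (real n ^ (r - t)) powr p" for n :: nat
  define ex where "ex n = ex_tp r t p n (expansion r F)" for n
  \<comment> \<open>An edge of F makes the edgeless r-graph free of the expansion, so the maximum in
    \<open>ex_tp\<close> is over a nonempty set and is attained.\<close>
  have "edges F \<noteq> {}"
  proof
    assume "edges F = {}"
    then have "colourable l F" unfolding colourable_def using l by (intro exI[of _ "\<lambda>_. 0"]) auto
    then show False using F(2) by blast
  qed
  then have ne: "edges (expansion r F) \<noteq> {}" by (simp add: expansion_def)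
  have lower: "\<forall>\<^sub>F n in sequentially. (\<Lambda> - \<epsilon>) * N n \<le> ex n" if "\<epsilon> > 0" for \<epsilon>
    using ex_tp_eventually_ge[OF F(1,2) r p l x(1) that] unfolding x(2) N_def ex_def .
  have upper': "\<forall>\<^sub>F n in sequentially. ex n \<le> (\<Lambda> + \<epsilon>) * N n" if \<epsilon>: "\<epsilon> > 0" for \<epsilon>
  proof -
    have \<epsilon>2: "\<epsilon> / 2 > 0" using \<epsilon> by simp
    obtain m \<delta>' where m: "\<delta>' > 0" "\<forall>(V :: nat set) E. finite V \<longrightarrow> m \<le> card V \<longrightarrow>
      (\<forall>a b. E a b \<longrightarrow> E b a) \<longrightarrow>
      real (card {S \<in> nsets V (l + 1). clique E S}) \<le> \<delta>' * real (card V) ^ (l + 1) \<longrightarrow>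
      wnorm (clique E) t (r - t) p V (\<lambda>_. 1) \<le> (\<Lambda> + \<epsilon> / 2) * (real (card V) ^ t * (real (card V) ^ (r - t)) powr p)"
      using upper[OF \<epsilon>2] by (elim exE conjE)
    obtain \<delta> where \<delta>: "\<delta> > 0" "\<And>H :: nat hypergraph. uniform r H \<Longrightarrow> verts H \<noteq> {} \<Longrightarrow> tp_norm t p H \<le>
      wnorm (clique (\<lambda>u v. u \<noteq> v \<and> \<delta> * (real (card (verts H)) ^ r / real (card (verts H)) ^ 2) \<le> real (deg H {u, v})))
        t (r - t) p (verts H) (\<lambda>_. 1)
      + \<epsilon> / 2 * (real (card (verts H)) ^ t * (real (card (verts H)) ^ (r - t)) powr p)"
      by (rule tp_norm_le_wnorm_rich_cliques[OF p \<epsilon>2 r(2), where 'a = nat]) (rule that; blast)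
    \<comment> \<open>\<open>N0\<close> comes last, since it depends on the threshold \<delta> of
      rich pairs and on the clique density \<delta>'.\<close>
    obtain N0 where N0: "\<forall>H :: nat hypergraph. uniform r H \<longrightarrow> \<not> contains_copy (expansion r F) H \<longrightarrow> N0 \<le> card (verts H) \<longrightarrow>
      real (card {S \<in> nsets (verts H) (l + 1).
        clique (\<lambda>u v. u \<noteq> v \<and> \<delta> * (real (card (verts H)) ^ r / real (card (verts H)) ^ 2) \<le> real (deg H {u, v})) S})
      \<le> \<delta>' * real (card (verts H)) ^ (l + 1)"
      using few_rich_cliques[OF F(1,3) \<delta>(1) m(1), of r] by (elim exE)
    show ?thesis
      using eventually_ge_at_top[of "max 1 (max m N0)"]
    proof eventually_elim
      case (elim n)
      obtain H :: "nat hypergraph" where H: "verts H = {1..n}" "uniform r H"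
        "\<not> contains_copy (expansion r F) H" "tp_norm t p H = ex n"
        unfolding ex_def by (rule ex_tp_attained[OF ne])
      define E where "E = (\<lambda>u v. u \<noteq> v \<and> \<delta> * (real (card (verts H)) ^ r / real (card (verts H)) ^ 2) \<le> real (deg H {u, v}))"
      have cardH: "card (verts H) = n" "finite (verts H)" "verts H \<noteq> {}" using H(1) elim by auto
      have "real (card {S \<in> nsets (verts H) (l + 1). clique E S}) \<le> \<delta>' * real (card (verts H)) ^ (l + 1)"
        unfolding E_def using H(2,3) cardH(1) elim by (intro N0[rule_format]) simp_all
      moreover have "E a b \<Longrightarrow> E b a" for a b by (simp add: E_def insert_commute)
      moreover have "m \<le> card (verts H)" using cardH elim by simp
      ultimately have "wnorm (clique E) t (r - t) p (verts H) (\<lambda>_. 1)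
          \<le> (\<Lambda> + \<epsilon> / 2) * (real (card (verts H)) ^ t * (real (card (verts H)) ^ (r - t)) powr p)"
        using m(2) cardH(2) by blast
      moreover have "tp_norm t p H \<le> wnorm (clique E) t (r - t) p (verts H) (\<lambda>_. 1)
          + \<epsilon> / 2 * (real (card (verts H)) ^ t * (real (card (verts H)) ^ (r - t)) powr p)"
        unfolding E_def using \<delta>(2)[OF H(2) cardH(3)] .
      ultimately have "ex n \<le> (\<Lambda> + \<epsilon> / 2) * N n + \<epsilon> / 2 * N n"
        unfolding H(4) cardH(1) N_def by linarith
      then show ?case by (simp add: algebra_simps)
    qed
  qed
  have Npos: "N n > 0" if "n > 0" for n using that by (simp add: N_def)
  have "(\<lambda>n. ex n / N n) \<longlonglongrightarrow> \<Lambda>"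
  proof (rule order_tendstoI)
    fix y assume y: "y < \<Lambda>"
    then have "(\<Lambda> - y) / 2 > 0" by simp
    from lower[OF this] show "\<forall>\<^sub>F n in sequentially. y < ex n / N n"
      using eventually_gt_at_top[of 0]
    proof eventually_elim
      case (elim n)
      have "y < \<Lambda> - (\<Lambda> - y) / 2" using y by (simp add: field_simps)
      also have "\<dots> \<le> ex n / N n" using elim Npos by (simp add: pos_le_divide_eq)
      finally show ?case .
    qed
  next
    fix y assume y: "\<Lambda> < y"
    then have "(y - \<Lambda>) / 2 > 0" by simp
    from upper'[OF this] show "\<forall>\<^sub>F n in sequentially. ex n / N n < y"
      using eventually_gt_at_top[of 0]
    proof eventually_elim
      case (elim n)
      have "ex n / N n \<le> \<Lambda> + (y - \<Lambda>) / 2" using elim Npos by (simp add: pos_divide_le_eq)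
      also have "\<dots> < y" using y by (simp add: field_simps)
      finally show ?case .
    qed
  qed
  then have "(\<lambda>n. fact t * (ex n / N n)) \<longlonglongrightarrow> fact t * \<Lambda>" by (intro tendsto_intros)
  moreover have "\<forall>\<^sub>F n in sequentially. fact t * (ex n / N n) = tp_ratio r t p (expansion r F) n"
    using eventually_gt_at_top[of 0]
    by eventually_elim (simp add: tp_ratio_def ex_def N_def power_powr_combine)
  ultimately show ?thesis by (rule Lim_transform_eventually)
qed

text \<open>Giving each vertex its own colour is proper, so the \<open>LEAST\<close> is
  attained.\<close>

lemma colourable_chromatic_number:
  assumes F: "uniform 2 F"
  shows "colourable (chromatic_number F) F"
  unfolding chromatic_number_def
proof (rule LeastI)
  have "finite (verts F)" using F by (simp add: uniform_def)
  then obtain c where c: "bij_betw c (verts F) {0..<card (verts F)}"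
    using ex_bij_betw_finite_nat by blast
  show "colourable (card (verts F)) F"
    unfolding colourable_def
  proof (intro exI[of _ c] conjI allI impI)
    show "c ` verts F \<subseteq> {..<card (verts F)}" using c by (auto simp: bij_betw_def)
    fix u v assume "u \<noteq> v" "{u, v} \<in> edges F"
    moreover from this have "u \<in> verts F" "v \<in> verts F" using F by (auto simp: uniform_def nsets_def)
    ultimately show "c u \<noteq> c v" using c by (auto simp: bij_betw_def inj_on_def)
  qed
qed

text \<open>\<open>tp_density\<close> is a \<open>lim\<close>, which is informative only for a
  convergent sequence; therefore convergence is part of the claim.\<close>

theorem corollary1p6:
  fixes l r t :: nat and p :: real and F :: "'a hypergraph"
  assumes "l \<ge> r" and "r > t" and "t \<ge> 1" and "p > 0"
    and "uniform 2 F" and "chromatic_number F = l + 1"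
  shows "convergent (tp_ratio r t p (expansion r F)) \<and>
    tp_density r t p (expansion r F) =
      (if p < 1
       then fact t * real (l choose t) * real ((l - t) choose (r - t)) powr p
              * (1 / real l) powr (real t + p * real (r - t))
       else fact t * lagrangian r t p (complete_hypergraph r {1..l}))"
proof -
  have rl: "r \<ge> 2" "t \<le> r" "l \<ge> 1" "t + (r - t) = r" "t + (r - t) \<le> l" using assms(1-3) by auto
  have F: "colourable (l + 1) F" "\<not> colourable l F"
    using colourable_chromatic_number[OF assms(5)] not_less_Least[of l "\<lambda>k. colourable k F"] assms(6)
    by (simp_all add: chromatic_number_def)
  let ?R = "tp_ratio r t p (expansion r F)"
  let ?w = "wnorm (\<lambda>_. True) t (r - t) p {1..l}"
  have lim: "?R \<longlonglongrightarrow> fact t * (if p < 1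
       then real (l choose t) * (1 / real l) ^ t * (real ((l - t) choose (r - t)) * (1 / real l) ^ (r - t)) powr p
       else lagrangian r t p (complete_hypergraph r {1..l}))"
  proof (cases "p < 1")
    case True
    \<comment> \<open>Uniform weights meet the upper bound for p < 1: all link sums are equal, so
      the power mean inequality is tight.\<close>
    define x where "x i = (if i \<in> {1..l} then 1 / real l else 0)" for i
    define \<Lambda> where "\<Lambda> = real (l choose t) * (1 / real l) ^ t * (real ((l - t) choose (r - t)) * (1 / real l) ^ (r - t)) powr p"
    have x: "x \<in> std_simplex {1..l}" using rl(3) by (auto simp: std_simplex_def x_def)
    have const: "(\<Prod>i\<in>S. x i) = (1 / real l) ^ j" if "S \<in> nsets {1..l} j" for S j
    proof -
      have "(\<Prod>i\<in>S. x i) = (\<Prod>i\<in>S. 1 / real l)" using that by (intro prod.cong) (auto simp: nsets_def x_def)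
      then show ?thesis using that by (simp add: nsets_def)
    qed
    have "?w x = (\<Sum>T\<in>nsets {1..l} t. (1 / real l) ^ t * (real ((l - t) choose (r - t)) * (1 / real l) ^ (r - t)) powr p)"
      unfolding wnorm_def
    proof (intro sum.cong refl arg_cong2[where f = "(*)"] arg_cong2[where f = "(powr)"] const)
      fix T assume T: "T \<in> nsets {1..l} t"
      have "(\<Sum>I\<in>{I \<in> nsets ({1..l} - T) (r - t). True}. \<Prod>i\<in>I. x i)
          = (\<Sum>I\<in>nsets ({1..l} - T) (r - t). (1 / real l) ^ (r - t))"
        by (intro sum.cong const) (auto simp: nsets_def)
      then show "(\<Sum>I\<in>{I \<in> nsets ({1..l} - T) (r - t). True}. \<Prod>i\<in>I. x i)
          = real ((l - t) choose (r - t)) * (1 / real l) ^ (r - t)"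
        using T by (simp add: nsets_choose) (simp add: nsets_def card_Diff_subset)
    qed
    then have w: "?w x = \<Lambda>" by (simp add: nsets_choose \<Lambda>_def)
    have "?R \<longlonglongrightarrow> fact t * \<Lambda>"
    proof (rule tp_ratio_expansion_tendsto[OF assms(5) F(2,1) rl(1,2) assms(4) rl(3) x w])
      fix \<epsilon> :: real assume "\<epsilon> > 0"
      show "\<exists>m \<delta>. \<delta> > 0 \<and> (\<forall>(V :: nat set) E. finite V \<longrightarrow> m \<le> card V \<longrightarrow>
        (\<forall>a b. E a b \<longrightarrow> E b a) \<longrightarrow>
        real (card {S \<in> nsets V (l + 1). clique E S}) \<le> \<delta> * real (card V) ^ (l + 1) \<longrightarrow>
        wnorm (clique E) t (r - t) p V (\<lambda>_. 1) \<le> (\<Lambda> + \<epsilon>) * (real (card V) ^ t * (real (card V) ^ (r - t)) powr p))"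
      proof (rule wnorm_few_cliques_le_concave[OF assms(4) True \<open>\<epsilon> > 0\<close> rl(3,5), folded \<Lambda>_def])
        fix m \<delta>
        assume "\<delta> > 0" and bound: "\<And>(V :: nat set) E. finite V \<Longrightarrow> m \<le> card V \<Longrightarrow> (\<And>a b. E a b \<Longrightarrow> E b a) \<Longrightarrow>
          real (card {S \<in> nsets V (l + 1). clique E S}) \<le> \<delta> * real (card V) ^ (l + 1) \<Longrightarrow>
          wnorm (clique E) t (r - t) p V (\<lambda>_. 1) \<le> (\<Lambda> + \<epsilon>) * (real (card V) ^ t * (real (card V) ^ (r - t)) powr p)"
        then show ?thesis by (intro exI[of _ m] exI[of _ \<delta>] conjI allI impI) (assumption, rule bound, auto)
      qed
    qed
    then show ?thesis using True by (simp add: \<Lambda>_def)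
  next
    case False
    then have p1: "p \<ge> 1" by simp
    define \<Lambda> where "\<Lambda> = lagrangian r t p (complete_hypergraph r {1..l})"
    have poly: "lagrange_poly r t p (complete_hypergraph r {1..l}) y = ?w y" for y
      by (rule lagrange_poly_complete[OF _ rl(2)]) simp
    have vs: "verts (complete_hypergraph r {1..l}) = {1..l}" by (simp add: complete_hypergraph_def)
    have G: "finite (verts (complete_hypergraph r {1..l}))" "verts (complete_hypergraph r {1..l}) \<noteq> {}"
      using rl(3) unfolding vs by auto
    \<comment> \<open>That the supremum is attained serves both sides: its maximiser is the blow-up,
      and its maximality bounds the norm after symmetrisation.\<close>
    obtain x where x: "x \<in> std_simplex {1..l}" "?w x = \<Lambda>" "\<And>y. y \<in> std_simplex {1..l} \<Longrightarrow> ?w y \<le> \<Lambda>"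
      by (rule lagrangian_max[OF G assms(4), of r t, unfolded poly vs, folded \<Lambda>_def]) (rule that; blast)
    have \<Lambda>0: "\<Lambda> \<ge> 0"
      unfolding x(2)[symmetric] using x(1) by (intro wnorm_nonneg) (simp add: std_simplex_def)
    have "?R \<longlonglongrightarrow> fact t * \<Lambda>"
    proof (rule tp_ratio_expansion_tendsto[OF assms(5) F(2,1) rl(1,2) assms(4) rl(3) x(1,2)])
      fix \<epsilon> :: real assume "\<epsilon> > 0"
      show "\<exists>m \<delta>. \<delta> > 0 \<and> (\<forall>(V :: nat set) E. finite V \<longrightarrow> m \<le> card V \<longrightarrow>
        (\<forall>a b. E a b \<longrightarrow> E b a) \<longrightarrow>
        real (card {S \<in> nsets V (l + 1). clique E S}) \<le> \<delta> * real (card V) ^ (l + 1) \<longrightarrow>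
        wnorm (clique E) t (r - t) p V (\<lambda>_. 1) \<le> (\<Lambda> + \<epsilon>) * (real (card V) ^ t * (real (card V) ^ (r - t)) powr p))"
      proof (rule wnorm_few_cliques_le[OF p1 \<open>\<epsilon> > 0\<close> x(3) \<Lambda>0])
        fix m \<delta>
        assume "\<delta> > 0" and bound: "\<And>(V :: nat set) E. finite V \<Longrightarrow> m \<le> card V \<Longrightarrow> (\<And>a b. E a b \<Longrightarrow> E b a) \<Longrightarrow>
          real (card {S \<in> nsets V (l + 1). clique E S}) \<le> \<delta> * real (card V) ^ (l + 1) \<Longrightarrow>
          wnorm (clique E) t (r - t) p V (\<lambda>_. 1) \<le> (\<Lambda> + \<epsilon>) * (real (card V) ^ t * (real (card V) ^ (r - t)) powr p)"
        then show ?thesis by (intro exI[of _ m] exI[of _ \<delta>] conjI allI impI) (assumption, rule bound, auto)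
      qed
    qed
    then show ?thesis using False by (simp add: \<Lambda>_def)
  qed
  have "(real ((l - t) choose (r - t)) * (1 / real l) ^ (r - t)) powr p * (1 / real l) ^ t
      = real ((l - t) choose (r - t)) powr p * (1 / real l) powr (real t + p * real (r - t))"
    using rl(3) by (simp add: powr_mult flip: power_powr_combine)
  then have eq: "fact t * (if p < 1
       then real (l choose t) * (1 / real l) ^ t * (real ((l - t) choose (r - t)) * (1 / real l) ^ (r - t)) powr p
       else lagrangian r t p (complete_hypergraph r {1..l}))
    = (if p < 1
       then fact t * real (l choose t) * real ((l - t) choose (r - t)) powr p
              * (1 / real l) powr (real t + p * real (r - t))
       else fact t * lagrangian r t p (complete_hypergraph r {1..l}))"
    by (simp add: mult.assoc mult.commute mult.left_commute)
  show ?thesis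
    using lim convergentI[OF lim] limI[OF lim] unfolding eq tp_density_def by blast
qed

end
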